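(* Let $(X,Y,\mu,\nu,c)$ be a compact OT problem and let $\mathrm{K}_*$ be the optimal value of its Kantorovich problem. Then, for all $h,\varepsilon\ge 0$, every $\varepsilon$-optimal $h$-plan $\pi_h$ for $(X,Y,\mu,\nu,c)$ satisfies $$\big|\mathrm{K}[\pi_h]-\mathrm{K}_*\big|\le \omega_c(h)+\varepsilon ,$$ and for every approximating sequence of discrete plans $(\pi_k)_k$ for $(X,Y,\mu,\nu,c)$ we have $$\mathrm{K}[\pi_k]\to \mathrm{K}_* \quad\text{and}\quad W_p(\pi_k,\mathcal{O}_{KP})\to 0 \ \text{ for all } 1\le p<\infty \qquad (k\to\infty).$$ In particular, if moreover the Kantorovich problem has a unique optimal transport plan $\pi_*\in\mathcal{A}(\mu,\nu)$, then $W_p(\pi_k,\pi_* )\to 0$ for all $1\le p<\infty$.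
   Context: An OT problem is a quintuple $(X,Y,\mu,\nu,c)$ where $(X,d_X)$, $(Y,d_Y)$ are Polish metric spaces, $\mu\in\mathcal{P}(X)$, $\nu\in\mathcal{P}(Y)$ are Borel probability measures and $c:X\times Y\to\mathbb{R}$ is Borel. It is compact if $X,Y$ are compact and $c$ is continuous. $X\times Y$ carries the metric $d_{X\times Y}((x_1,y_1),(x_2,y_2))=\max\{d_X(x_1,x_2),d_Y(y_1,y_2)\}$. In the compact case $\omega_c(h)=\max\{|c(z_1)-c(z_2)| : z_1,z_2\in X\times Y,\ d_{X\times Y}(z_1,z_2)\le h\}$. $\mathcal{A}(\mu,\nu)$ is the set of Borel probability measures on $X\times Y$ with marginals $\mu$ and $\nu$ (transport plans). $\mathrm{K}[\pi]=\int_{X\times Y}c\,d\pi$. The Kantorovich problem is to minimize $\mathrm{K}[\pi]$ over $\pi\in\mathcal{A}(\mu,\nu)$; $\mathrm{K}_*$ is its optimal value and $\mathcal{O}_{KP}=\{\pi\in\mathcal{A}(\mu,\nu):\mathrm{K}[\pi]=\mathrm{K}_*\}$. $W_p$ ($1\le p<\infty$) is the $p$-Wasserstein distance on $\mathcal{P}(X\times Y)$ associated with $d_{X\times Y}$, and $W_p(\pi,\mathcal{O})=\inf_{\tilde\pi\in\mathcal{O}}W_p(\pi,\tilde\pi)$. Discretization: for $h\ge 0$, an $h$-partition of a metric space $Z$ is a finite family $\{(E_i,z_i)\}_{i\in I}$ where the $E_i$ are pairwise disjoint Borel sets covering $Z$, $z_i\in E_i$ and $\operatorname{diam}(E_i)\le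 h$. Given $h$-partitions $\{(E_i,x_i)\}_{i\in I}$ of $X$ and $\{(F_j,y_j)\}_{j\in J}$ of $Y$, put $\mu_i=\mu[E_i]$, $\nu_j=\nu[F_j]$, $c_{ij}=c(x_i,y_j)$. An $h$-plan is a family $\pi_h=(\pi_{ij})_{(i,j)\in I\times J}$ of nonnegative reals with $\sum_j\pi_{ij}=\mu_i$ for all $i$ and $\sum_i\pi_{ij}=\nu_j$ for all $j$, identified with the measure $\sum_{ij}\pi_{ij}\delta_{(x_i,y_j)}$ on $X\times Y$; so $\mathrm{K}[\pi_h]=\sum_{ij}\pi_{ij}c_{ij}$. It is $\varepsilon$-optimal ($\varepsilon\ge 0$) if $\mathrm{K}[\pi_h]\le\varepsilon+\mathrm{K}[\tilde\pi_h]$ for every other $h$-plan $\tilde\pi_h$ built from the same pair of $h$-partitions; optimal means $0$-optimal. An approximating sequence of discrete plans is a sequence $(\pi_k)_k$ such that each $\pi_k$ is an $\varepsilon_k$-optimal $h_k$-plan (the partitions may vary with $k$), where $\varepsilon_k\to 0$ and $h_k\to 0$. *)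

theory Defs
  imports "HOL-Probability.Probability"
begin

text \<open>
  A Polish metric space is a type of class \<^class>\<open>polish_space\<close>, with the metric \<^const>\<open>dist\<close>;
  Borel probability measures on it are the elements of \<open>space (prob_algebra borel)\<close>.
  The library metric on a product type is the Euclidean one. It induces the same topology, hence
  the same Borel sets, as the maximum metric below, but different distances; so everything
  metric on a product refers to \<open>max_dist\<close> explicitly.
\<close>

definition max_dist :: "'a::metric_space \<times> 'b::metric_space \<Rightarrow> 'a \<times> 'b \<Rightarrow> real" where
  "max_dist z z' = max (dist (fst z) (fst z')) (dist (snd z) (snd z'))"

definition OT_problem ::
  "'a::polish_space measure \<Rightarrow> 'b::polish_space measure \<Rightarrow> ('a \<times> 'b \<Rightarrow> real) \<Rightarrow> bool" where
  "OT_problem \<mu> \<nu> c \<longleftrightarrow>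
     \<mu> \<in> space (prob_algebra borel) \<and> \<nu> \<in> space (prob_algebra borel) \<and> c \<in> borel_measurable borel"

definition compact_OT_problem ::
  "'a::polish_space measure \<Rightarrow> 'b::polish_space measure \<Rightarrow> ('a \<times> 'b \<Rightarrow> real) \<Rightarrow> bool" where
  "compact_OT_problem \<mu> \<nu> c \<longleftrightarrow>
     OT_problem \<mu> \<nu> c \<and> compact (UNIV :: 'a set) \<and> compact (UNIV :: 'b set) \<and> continuous_on UNIV c"

definition transport_plans ::
  "'a::topological_space measure \<Rightarrow> 'b::topological_space measure \<Rightarrow> ('a \<times> 'b) measure set" where
  "transport_plans \<mu> \<nu> =
     {\<pi> \<in> space (prob_algebra borel). distr \<pi> borel fst = \<mu> \<and> distr \<pi> borel snd = \<nu>}"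

definition transport_cost :: "('z \<Rightarrow> real) \<Rightarrow> 'z measure \<Rightarrow> real" where
  "transport_cost c \<pi> = (\<integral>z. c z \<partial>\<pi>)"

definition Kantorovich_value ::
  "'a::topological_space measure \<Rightarrow> 'b::topological_space measure \<Rightarrow> ('a \<times> 'b \<Rightarrow> real) \<Rightarrow> real" where
  "Kantorovich_value \<mu> \<nu> c = (INF \<pi>\<in>transport_plans \<mu> \<nu>. transport_cost c \<pi>)"

definition optimal_plans ::
  "'a::topological_space measure \<Rightarrow> 'b::topological_space measure \<Rightarrow> ('a \<times> 'b \<Rightarrow> real) \<Rightarrow>
     ('a \<times> 'b) measure set" where
  "optimal_plans \<mu> \<nu> c =
     {\<pi> \<in> transport_plans \<mu> \<nu>. transport_cost c \<pi> = Kantorovich_value \<mu> \<nu> c}"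

text \<open>In the compact case the supremum is a maximum; see \<open>cost_modulus_attained\<close>.\<close>

definition cost_modulus :: "('a::metric_space \<times> 'b::metric_space \<Rightarrow> real) \<Rightarrow> real \<Rightarrow> real" where
  "cost_modulus c h = Sup {\<bar>c z - c z'\<bar> | z z'. max_dist z z' \<le> h}"

definition ennreal_powr :: "ennreal \<Rightarrow> real \<Rightarrow> ennreal" where
  "ennreal_powr x a = (if x = \<top> then \<top> else ennreal (enn2real x powr a))"

text \<open>
  The metric is an explicit argument because the Wasserstein distance is needed for
  \<^const>\<open>max_dist\<close>. Values are extended reals, so that non-existing moments and the infimum
  over an empty set give \<open>\<infinity>\<close> rather than a default value.
\<close>

definition wasserstein ::
  "('z::topological_space \<Rightarrow> 'z \<Rightarrow> real) \<Rightarrow> real \<Rightarrow> 'z measure \<Rightarrow> 'z measure \<Rightarrow> ennreal" where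
  "wasserstein d p P Q =
     ennreal_powr (INF \<gamma>\<in>transport_plans P Q. \<integral>\<^sup>+ z. ennreal (d (fst z) (snd z) powr p) \<partial>\<gamma>) (1 / p)"

definition wasserstein_set ::
  "('z::topological_space \<Rightarrow> 'z \<Rightarrow> real) \<Rightarrow> real \<Rightarrow> 'z measure \<Rightarrow> 'z measure set \<Rightarrow> ennreal" where
  "wasserstein_set d p P S = (INF Q\<in>S. wasserstein d p P Q)"

record ('i, 'z) tagged_family =
  index :: "'i set"
  cell :: "'i \<Rightarrow> 'z set"
  tag :: "'i \<Rightarrow> 'z"

text \<open>Boundedness of the cells is part of \<open>diam \<le> h\<close>: \<^const>\<open>diameter\<close> is real-valued and
  says nothing about unbounded sets.\<close>

definition h_partition :: "real \<Rightarrow> ('i, 'z::metric_space) tagged_family \<Rightarrow> bool" where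
  "h_partition h T \<longleftrightarrow>
     finite (index T) \<and> disjoint_family_on (cell T) (index T) \<and> (\<Union>i\<in>index T. cell T i) = UNIV \<and>
     (\<forall>i\<in>index T. cell T i \<in> sets borel \<and> tag T i \<in> cell T i \<and>
        bounded (cell T i) \<and> diameter (cell T i) \<le> h)"

definition h_plan ::
  "'a::metric_space measure \<Rightarrow> 'b::metric_space measure \<Rightarrow> real \<Rightarrow>
     ('i, 'a) tagged_family \<Rightarrow> ('j, 'b) tagged_family \<Rightarrow> ('i \<Rightarrow> 'j \<Rightarrow> real) \<Rightarrow> bool" where
  "h_plan \<mu> \<nu> h S T w \<longleftrightarrow>
     h_partition h S \<and> h_partition h T \<and>
     (\<forall>i\<in>index S. \<forall>j\<in>index T. 0 \<le> w i j) \<and>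
     (\<forall>i\<in>index S. (\<Sum>j\<in>index T. w i j) = measure \<mu> (cell S i)) \<and>
     (\<forall>j\<in>index T. (\<Sum>i\<in>index S. w i j) = measure \<nu> (cell T j))"

text \<open>The Borel measure that assigns mass \<open>w i j\<close> to the point \<open>(tag S i, tag T j)\<close>.\<close>

definition plan_measure ::
  "('i, 'a::topological_space) tagged_family \<Rightarrow> ('j, 'b::topological_space) tagged_family \<Rightarrow>
     ('i \<Rightarrow> 'j \<Rightarrow> real) \<Rightarrow> ('a \<times> 'b) measure" where
  "plan_measure S T w =
     distr (point_measure (index S \<times> index T) (\<lambda>(i, j). ennreal (w i j))) borel
       (\<lambda>(i, j). (tag S i, tag T j))"

definition eps_optimal_h_plan ::
  "'a::metric_space measure \<Rightarrow> 'b::metric_space measure \<Rightarrow> ('a \<times> 'b \<Rightarrow> real) \<Rightarrow> real \<Rightarrow> real \<Rightarrow>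
     ('i, 'a) tagged_family \<Rightarrow> ('j, 'b) tagged_family \<Rightarrow> ('i \<Rightarrow> 'j \<Rightarrow> real) \<Rightarrow> bool" where
  "eps_optimal_h_plan \<mu> \<nu> c \<epsilon> h S T w \<longleftrightarrow>
     0 \<le> \<epsilon> \<and> 0 \<le> h \<and> h_plan \<mu> \<nu> h S T w \<and>
     (\<forall>w'. h_plan \<mu> \<nu> h S T w' \<longrightarrow>
        transport_cost c (plan_measure S T w) \<le> \<epsilon> + transport_cost c (plan_measure S T w'))"

definition approximating_sequence ::
  "'a::metric_space measure \<Rightarrow> 'b::metric_space measure \<Rightarrow> ('a \<times> 'b \<Rightarrow> real) \<Rightarrow>
     (nat \<Rightarrow> ('i, 'a) tagged_family) \<Rightarrow> (nat \<Rightarrow> ('j, 'b) tagged_family) \<Rightarrow>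
     (nat \<Rightarrow> 'i \<Rightarrow> 'j \<Rightarrow> real) \<Rightarrow> bool" where
  "approximating_sequence \<mu> \<nu> c S T w \<longleftrightarrow>
     (\<exists>\<epsilon> h. \<epsilon> \<longlonglongrightarrow> 0 \<and> h \<longlonglongrightarrow> 0 \<and>
        (\<forall>k. eps_optimal_h_plan \<mu> \<nu> c (\<epsilon> k) (h k) (S k) (T k) (w k)))"


lemma cost_modulus_attained:
  fixes c :: "'a::polish_space \<times> 'b::polish_space \<Rightarrow> real"
  assumes "compact_OT_problem \<mu> \<nu> c" "0 \<le> h"
  shows "\<exists>z z'. max_dist z z' \<le> h \<and> cost_modulus c h = \<bar>c z - c z'\<bar>"
    and "max_dist z z' \<le> h \<Longrightarrow> \<bar>c z - c z'\<bar> \<le> cost_modulus c h"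
proof -
  let ?D = "{p :: ('a \<times> 'b) \<times> ('a \<times> 'b). max_dist (fst p) (snd p) \<le> h}"
  let ?f = "\<lambda>p :: ('a \<times> 'b) \<times> ('a \<times> 'b). \<bar>c (fst p) - c (snd p)\<bar>"
  have cpt: "compact (UNIV :: 'a set)" "compact (UNIV :: 'b set)" and cont: "continuous_on UNIV c"
    using assms by (auto simp: compact_OT_problem_def)
  have "compact (UNIV \<times> UNIV :: ('a \<times> 'b) set)"
    using cpt by (intro compact_Times)
  then have "compact (UNIV \<times> UNIV :: (('a \<times> 'b) \<times> ('a \<times> 'b)) set)"
    by (intro compact_Times) (simp_all add: UNIV_Times_UNIV)
  moreover have "closed ?D"
    unfolding max_dist_def by (intro closed_Collect_le continuous_intros)
  ultimately have D: "compact ?D"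
    by (metis UNIV_Times_UNIV closed_Int_compact Int_UNIV_right)
  have "continuous_on ?D ?f"
    by (intro continuous_intros continuous_on_compose2[OF cont]) auto
  then have img: "compact (?f ` ?D)"
    using D by (rule compact_continuous_image)
  have eq: "{\<bar>c z - c z'\<bar> | z z'. max_dist z z' \<le> h} = ?f ` ?D"
    by (auto simp: image_def)
  have "((undefined, undefined), (undefined, undefined)) \<in> ?D"
    using assms by (simp add: max_dist_def)
  then have ne: "?f ` ?D \<noteq> {}"
    by blast
  have bdd: "bdd_above (?f ` ?D)"
    using img by (intro bounded_imp_bdd_above compact_imp_bounded)
  have "cost_modulus c h \<in> ?f ` ?D"
    unfolding cost_modulus_def eq
    using closed_contains_Sup[OF ne bdd] img compact_imp_closed by blast
  then show "\<exists>z z'. max_dist z z' \<le> h \<and> cost_modulus c h = \<bar>c z - c z'\<bar>"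
    by (metis (mono_tags, lifting) imageE mem_Collect_eq)
  show "max_dist z z' \<le> h \<Longrightarrow> \<bar>c z - c z'\<bar> \<le> cost_modulus c h"
    unfolding cost_modulus_def eq by (rule cSup_upper[OF _ bdd]) (rule image_eqI[where x = "(z, z')"]; simp)
qed

lemma emeasure_plan_measure:
  assumes "finite (index S)" "finite (index T)" "A \<in> sets borel"
  shows "emeasure (plan_measure S T w) A =
    (\<Sum>i\<in>index S. \<Sum>j\<in>index T. ennreal (w i j) * indicator A (tag S i, tag T j))"
proof -
  let ?I = "index S \<times> index T"
  let ?V = "{p \<in> ?I. (tag S (fst p), tag T (snd p)) \<in> A}"
  have "emeasure (plan_measure S T w) A =
      emeasure (point_measure ?I (\<lambda>(i, j). ennreal (w i j))) ?V"
    unfolding plan_measure_def using assms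
    by (subst emeasure_distr)
       (auto simp: space_point_measure intro!: arg_cong[where f = "emeasure _"])
  also have "\<dots> = (\<Sum>p\<in>?V. ennreal (w (fst p) (snd p)))"
    using assms by (subst emeasure_point_measure_finite) (auto simp: case_prod_beta)
  also have "\<dots> = (\<Sum>p\<in>?I. ennreal (w (fst p) (snd p)) * indicator A (tag S (fst p), tag T (snd p)))"
    using assms by (intro sum.mono_neutral_cong_left) (auto simp: indicator_def)
  finally show ?thesis
    by (simp add: sum.cartesian_product case_prod_beta)
qed

lemma transport_cost_plan_measure:
  assumes "finite (index S)" "finite (index T)" "c \<in> borel_measurable borel"
    and "\<And>i j. i \<in> index S \<Longrightarrow> j \<in> index T \<Longrightarrow> 0 \<le> w i j"
  shows "transport_cost c (plan_measure S T w) =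
    (\<Sum>i\<in>index S. \<Sum>j\<in>index T. w i j * c (tag S i, tag T j))"
proof -
  let ?I = "index S \<times> index T"
  have "transport_cost c (plan_measure S T w) =
      (\<integral>p. c (tag S (fst p), tag T (snd p)) \<partial>point_measure ?I (\<lambda>(i, j). ennreal (w i j)))"
    unfolding transport_cost_def plan_measure_def using assms
    by (subst integral_distr) (auto simp: case_prod_beta space_point_measure)
  also have "\<dots> =
      (\<integral>p. c (tag S (fst p), tag T (snd p)) \<partial>point_measure ?I (\<lambda>p. ennreal (w (fst p) (snd p))))"
    by (simp add: case_prod_unfold)
  also have "\<dots> = (\<Sum>p\<in>?I. w (fst p) (snd p) * c (tag S (fst p), tag T (snd p)))"
    using assms by (subst lebesgue_integral_point_measure_finite) auto
  finally show ?thesis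
    by (simp add: sum.cartesian_product case_prod_beta)
qed

end

theory Submission
  imports Defs
begin

text \<open>
  Spreading each mass \<open>w i j\<close> of an \<open>h\<close>-plan over its cell turns the \<open>h\<close>-plan into a transport plan,
  and the masses of the cells turn a transport plan into an \<open>h\<close>-plan; both operations change the cost
  by at most \<open>\<omega>\<^sub>c(h)\<close>, which gives the quantitative bound.

  For the Wasserstein convergence, the compact space \<open>X \<times> Y\<close> is coded by a Borel injection into
  the reals whose inverse extends continuously to the closure of its range. Helly selection and
  Skorohod representation on the reals then give, for a subsequence of the discrete plans, random
  variables with these laws that converge almost surely. The joint laws with the limit are
  couplings whose cost tends to \<open>0\<close> by dominated convergence. The law of the limit has the right
  marginals because the cost estimate also applies to the cost functions \<open>f \<circ> fst\<close> and
  \<open>f \<circ> snd\<close>, and it is optimal by the first part.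
\<close>

section \<open>Almost surely convergent subsequences on compact spaces\<close>

text \<open>Bits are read as ternary digits 0 and 1. In base 2 the sequences 0111... and 1000...
  would share a code; in base 3 later digits cannot make up for an earlier difference. The digit at
  position 0 has weight 1.\<close>

definition ternary_code :: "(nat \<Rightarrow> bool) \<Rightarrow> real" where
  "ternary_code b = (\<Sum>n. of_bool (b n) / 3 ^ n)"

lemma summable_inverse_pow3: "summable (\<lambda>n. 1 / 3 ^ (n + k) :: real)"
  using summable_ignore_initial_segment[OF complete_algebra_summable_geometric[of "1/3 :: real"], of k]
  by (simp add: power_divide)

text \<open>All positions after \<open>k\<close> together weigh half as much as position
  \<open>k\<close>; this deficit is the source of the gap between different codes.\<close>

lemma suminf_inverse_pow3: "(\<Sum>n. 1 / 3 ^ (n + Suc k) :: real) = 1 / (2 * 3 ^ k)"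
proof -
  have "(\<lambda>n. (1 / 3 ^ Suc k) * (1 / 3) ^ n :: real) sums ((1 / 3 ^ Suc k) * (1 / (1 - 1/3)))"
    by (intro sums_mult geometric_sums) simp
  then show ?thesis
    by (simp add: sums_iff power_divide power_add field_simps)
qed

lemma summable_ternary_code: "summable (\<lambda>n. of_bool (b n) / 3 ^ n :: real)"
  by (rule summable_comparison_test'[OF summable_inverse_pow3[of 0], of 0]) auto

text \<open>A common bound on the codes makes their laws tight. The sharp upper bound would be
  3/2.\<close>

lemma ternary_code_bounds: "ternary_code b \<in> {0..2}"
proof -
  have "ternary_code b \<le> (\<Sum>n. 1 / 3 ^ (n + 0))"
    unfolding ternary_code_def using summable_ternary_code summable_inverse_pow3[of 0]
    by (intro suminf_le) auto
  also have "\<dots> = (\<Sum>n. (1/3) ^ n)"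
    by (simp add: power_divide)
  also have "\<dots> \<le> (2::real)"
    by (subst suminf_geometric) auto
  finally show ?thesis
    using summable_ternary_code by (auto simp: ternary_code_def intro!: suminf_nonneg)
qed

text \<open>At the first position \<open>m\<close> where the sequences differ, the codes gain a
  difference of \<open>1 / 3 ^ m\<close>, and later positions can cancel at most half of it. A first
  difference at \<open>m \<le> N\<close> therefore keeps the codes at least
  \<open>1 / (2 * 3 ^ N)\<close> apart.\<close>

lemma ternary_code_close_imp_eq:
  assumes "\<bar>ternary_code a - ternary_code b\<bar> < 1 / (2 * 3 ^ N)" "n \<le> N"
  shows "a n = b n"
proof (rule ccontr)
  define d where "d m = (of_bool (a m) / 3 ^ m - of_bool (b m) / 3 ^ m :: real)" for m
  assume "a n \<noteq> b n"
  define m where "m = (LEAST m. a m \<noteq> b m)"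
  have m: "a m \<noteq> b m"
    unfolding m_def by (rule LeastI[of _ n]) fact
  have less: "a i = b i" if "i < m" for i
    using not_less_Least[OF that[unfolded m_def]] by simp
  have "m \<le> n"
    unfolding m_def by (rule Least_le) fact
  have d: "summable d"
    unfolding d_def by (intro summable_diff summable_ternary_code)
  have "ternary_code a - ternary_code b = suminf d"
    unfolding ternary_code_def d_def by (intro suminf_diff summable_ternary_code)
  also have "\<dots> = (\<Sum>i. d (i + Suc m)) + (\<Sum>i<Suc m. d i)"
    by (rule suminf_split_initial_segment[OF d])
  also have "(\<Sum>i<Suc m. d i) = d m"
    using less by (simp add: d_def)
  finally have eq: "ternary_code a - ternary_code b = (\<Sum>i. d (i + Suc m)) + d m" .
  have "norm (\<Sum>i. d (i + Suc m)) \<le> (\<Sum>i. 1 / 3 ^ (i + Suc m))"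
    by (intro norm_suminf_le summable_inverse_pow3) (simp add: d_def of_bool_def)
  then have "\<bar>\<Sum>i. d (i + Suc m)\<bar> \<le> 1 / (2 * 3 ^ m)"
    unfolding suminf_inverse_pow3 by simp
  moreover have "\<bar>d m\<bar> = 1 / 3 ^ m"
    using m by (auto simp: d_def of_bool_def)
  moreover have "1 / (2 * 3 ^ N) \<le> (1 / (2 * 3 ^ m) :: real)"
    using \<open>m \<le> n\<close> \<open>n \<le> N\<close> by (intro divide_left_mono) (auto intro: power_increasing)
  \<comment> \<open>The relation through which linear arithmetic compares the two reciprocals, which
    it treats as atoms.\<close>
  moreover have "1 / 3 ^ m = 2 * (1 / (2 * 3 ^ m) :: real)"
    by simp
  ultimately show False
    using assms(1) eq by linarith
qed

text \<open>The digits of the code record membership in the sets of a countable base. Finitely many of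
  these sets, all of small diameter, cover the compact space, so points with close codes lie in a
  common one.\<close>

lemma compact_borel_real_coding:
  assumes "compact (UNIV :: 'z::{complete_space, second_countable_topology} set)"
  obtains s :: "'z::{complete_space, second_countable_topology} \<Rightarrow> real" and K g where
    "s \<in> borel_measurable borel" "range s \<subseteq> {0..2}" "closed K" "range s \<subseteq> K"
    "continuous_on K g" "\<And>z. g (s z) = z"
proof -
  obtain B :: "'z set set" where B: "countable B" "topological_basis B"
    using ex_countable_basis by blast
  have "B \<noteq> {}"
    using topological_basisE[OF B(2) open_UNIV UNIV_I] by blast
  define U where "U = from_nat_into B"
  have U: "range U = B"
    unfolding U_def using B(1) \<open>B \<noteq> {}\<close> by (rule range_from_nat_into[rotated])
  have "open (U n)" for n
    using topological_basis_open[OF B(2)] U by blast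
  then have [measurable]: "U n \<in> sets borel" for n
    by (rule borel_open)
  define s where "s z = ternary_code (\<lambda>n. z \<in> U n)" for z
  have s[measurable]: "s \<in> borel_measurable borel"
  proof -
    have "(\<lambda>z. \<Sum>n. indicator (U n) z / 3 ^ n :: real) \<in> borel_measurable borel"
      by measurable
    then show ?thesis
      by (simp add: s_def[abs_def] ternary_code_def indicator_def of_bool_def)
  qed
  \<comment> \<open>This is uniform continuity of the inverse of \<open>s\<close>, phrased without
    the inverse because injectivity is derived from it.\<close>
  have sep: "\<exists>\<delta>>0. \<forall>z z'. \<bar>s z - s z'\<bar> < \<delta> \<longrightarrow> dist z z' < e" if "e > 0" for e
  proof -
    \<comment> \<open>Two points of one such basic set are less than \<open>e\<close> apart, by the
      triangle inequality through the centre \<open>x\<close>.\<close>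
    let ?I = "{n. \<exists>x. U n \<subseteq> ball x (e / 2)}"
    have "UNIV \<subseteq> (\<Union>n\<in>?I. U n)"
    proof
      fix z :: 'z
      obtain V where "V \<in> B" "z \<in> V" "V \<subseteq> ball z (e / 2)"
        using topological_basisE[OF B(2) open_ball, of z z "e / 2"] \<open>e > 0\<close> by auto
      then show "z \<in> (\<Union>n\<in>?I. U n)"
        using U by auto
    qed
    then obtain F where F: "F \<subseteq> ?I" "finite F" "UNIV \<subseteq> (\<Union>n\<in>F. U n)"
      by (rule compactE_image[where f = U and C = ?I, OF assms \<open>\<And>n. open (U n)\<close>])
    \<comment> \<open>By compactness only the digits up to \<open>N\<close> have to agree, and a
      code distance below \<open>1 / (2 * 3 ^ N)\<close> forces this.\<close>
    obtain N where N: "\<And>n. n \<in> F \<Longrightarrow> n \<le> N"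
      using finite_nat_set_iff_bounded_le[THEN iffD1, OF F(2)] by auto
    have "dist z z' < e" if close: "\<bar>s z - s z'\<bar> < 1 / (2 * 3 ^ N)" for z z'
    proof -
      obtain n where n: "n \<in> F" "z \<in> U n"
        using F(3) by blast
      then have "z' \<in> U n"
        using ternary_code_close_imp_eq[OF close[unfolded s_def] N[OF n(1)]] by simp
      moreover obtain x where "U n \<subseteq> ball x (e / 2)"
        using F(1) n(1) by blast
      ultimately have "dist x z < e / 2" "dist x z' < e / 2"
        using n(2) by auto
      then show ?thesis
        by (rule dist_triangle_half_r)
    qed
    then show ?thesis
      by (intro exI[of _ "1 / (2 * 3 ^ N)"] conjI) simp_all
  qed
  have "inj s"
  proof (rule injI, rule ccontr)
    fix z z' assume "s z = s z'" "z \<noteq> z'"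
    then obtain \<delta> where "\<delta> > 0" "\<bar>s z - s z'\<bar> < \<delta> \<longrightarrow> dist z z' < dist z z'"
      using sep[of "dist z z'"] zero_less_dist_iff by blast
    with \<open>s z = s z'\<close> show False
      by simp
  qed
  have "uniformly_continuous_on (range s) (inv s)"
    unfolding uniformly_continuous_on_def
  proof (intro allI impI)
    fix e :: real assume "e > 0"
    then obtain \<delta> where "\<delta> > 0" "\<And>z z'. \<bar>s z - s z'\<bar> < \<delta> \<Longrightarrow> dist z z' < e"
      using sep by blast
    then show "\<exists>d>0. \<forall>x\<in>range s. \<forall>x'\<in>range s. dist x' x < d \<longrightarrow> dist (inv s x') (inv s x) < e"
      by (intro exI[of _ \<delta>]) (auto simp: dist_real_def inv_f_f[OF \<open>inj s\<close>])
  qed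
  \<comment> \<open>Completeness of \<open>'z\<close> allows the extension. The closure is needed
    because \<open>s\<close> is Borel but need not be continuous, so a limit of codes need not be a
    code.\<close>
  then obtain g where g: "uniformly_continuous_on (closure (range s)) g"
    "\<And>x. x \<in> range s \<Longrightarrow> inv s x = g x"
    using uniformly_continuous_on_extension_on_closure by metis
  show thesis
  proof (rule that[OF s _ closed_closure closure_subset])
    show "range s \<subseteq> {0..2}"
      using ternary_code_bounds by (auto simp: s_def)
    show "continuous_on (closure (range s)) g"
      using g(1) by (rule uniformly_continuous_imp_continuous)
    show "g (s z) = z" for z
      using g(2)[of "s z"] inv_f_f[OF \<open>inj s\<close>] by simp
  qed
qed

section \<open>Skorohod representation on a compact space\<close>

text \<open>Encoding by \<open>s\<close> moves the laws to the real line, and decoding by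
  \<open>g\<close> carries the almost sure convergence back. The law of \<open>Y\<close> is left
  open; it is identified later from the limits of integrals.\<close>

lemma compact_skorohod_subsequence:
  fixes P :: "nat \<Rightarrow> 'z::{complete_space, second_countable_topology} measure"
  assumes "compact (UNIV :: 'z set)" and P: "\<And>k. P k \<in> space (prob_algebra borel)"
  obtains r :: "nat \<Rightarrow> nat" and \<Omega> :: "real measure" and X Y where
    "strict_mono r" "prob_space \<Omega>" "\<And>k. X k \<in> borel_measurable \<Omega>" "Y \<in> borel_measurable \<Omega>"
    "\<And>k. distr \<Omega> borel (X k) = P (r k)" "AE \<omega> in \<Omega>. (\<lambda>k. X k \<omega>) \<longlonglongrightarrow> Y \<omega>"
proof -
  obtain s :: "'z \<Rightarrow> real" and K g where s[measurable]: "s \<in> borel_measurable borel"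
    and bdd: "range s \<subseteq> {0..2}" and K: "closed K" "range s \<subseteq> K"
    and g: "continuous_on K g" "\<And>z. g (s z) = z"
    using compact_borel_real_coding[OF assms(1)] by metis
  have setsP[measurable_cong]: "sets (P k) = sets borel" and "prob_space (P k)" for k
    using P[of k] by (auto simp: space_prob_algebra)
  then interpret P: prob_space "P k" for k by simp
  define \<mu> where "\<mu> k = distr (P k) borel s" for k
  have mu: "real_distribution (\<mu> k)" for k
    unfolding \<mu>_def by (rule P.real_distribution_distr) measurable
  have "tight \<mu>"
    unfolding tight_def
  proof (intro conjI allI impI mu)
    fix e :: real assume "e > 0"
    \<comment> \<open>Tightness is phrased with half-open intervals, so \<open>{0..2}\<close> is
      placed strictly inside one.\<close>
    have "measure (\<mu> k) {-1<..3} = 1" for k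
    proof -
      have "s -` {-1<..3} \<inter> space (P k) = space (P k)"
        using bdd by (intro Int_absorb1 subsetI vimageI2 subsetD[OF _ rangeI[of s]]) auto
      then show ?thesis
        unfolding \<mu>_def by (subst measure_distr) (auto simp: P.prob_space)
    qed
    then show "\<exists>a b. a < b \<and> (\<forall>k. 1 - e < measure (\<mu> k) {a<..b})"
      using \<open>e > 0\<close> by (intro exI[of _ "-1"] exI[of _ 3]) auto
  qed
  \<comment> \<open>The theorem refines a given subsequence; applied to \<open>id\<close> it is
    Helly selection.\<close>
  then obtain r M where r: "strict_mono r" and M: "real_distribution M"
    and conv: "weak_conv_m (\<mu> \<circ> id \<circ> r) M"
    using tight_imp_convergent_subsubsequence strict_mono_id by metis
  have "\<exists>(\<Omega> :: real measure) Xs X. prob_space \<Omega> \<and> (\<forall>n. Xs n \<in> measurable \<Omega> borel) \<and>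
      (\<forall>n. distr \<Omega> borel (Xs n) = (\<mu> \<circ> id \<circ> r) n) \<and> X \<in> measurable \<Omega> lborel \<and>
      distr \<Omega> borel X = M \<and> (\<forall>x\<in>space \<Omega>. (\<lambda>n. Xs n x) \<longlonglongrightarrow> X x)"
    by (rule Skorohod[OF _ M conv]) (simp add: mu)
  then obtain \<Omega> :: "real measure" and Xs X where \<Omega>: "prob_space \<Omega>"
    and Xs[measurable]: "\<And>n. Xs n \<in> borel_measurable \<Omega>"
    and distr_Xs: "\<And>n. distr \<Omega> borel (Xs n) = \<mu> (r n)"
    and X[measurable]: "X \<in> borel_measurable \<Omega>"
    and lim: "\<And>x. x \<in> space \<Omega> \<Longrightarrow> (\<lambda>n. Xs n x) \<longlonglongrightarrow> X x"
    unfolding comp_def id_def measurable_lborel1 by blast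
  have [measurable]: "K \<in> sets borel"
    using K(1) by auto
  \<comment> \<open>The variables \<open>Xs k\<close> lie in \<open>K\<close> only almost surely, so
    decoding needs a Borel map on the whole line. Its value off \<open>K\<close> matters only on a
    null set.\<close>
  define G where "G x = (if x \<in> K then g x else undefined)" for x
  have [measurable]: "G \<in> borel_measurable borel"
    unfolding G_def using g(1) by (intro borel_measurable_continuous_on_if) auto
  have G_s: "G (s z) = z" for z
    using K(2) g(2) by (auto simp: G_def)
  have "AE x in \<mu> k. x \<in> K" for k
    unfolding \<mu>_def using K(2) by (subst AE_distr_iff) auto
  then have "AE x in \<Omega>. Xs k x \<in> K" for k
    using AE_distrD[OF Xs, of "\<lambda>x. x \<in> K"] unfolding distr_Xs by blast
  then have "AE x in \<Omega>. \<forall>k. Xs k x \<in> K"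
    by (simp add: AE_all_countable)
  moreover have "(\<lambda>k. G (Xs k x)) \<longlonglongrightarrow> G (X x)" if "x \<in> space \<Omega>" "\<forall>k. Xs k x \<in> K" for x
  proof -
    \<comment> \<open>Closedness keeps the limit in the domain where \<open>g\<close> is
      continuous.\<close>
    have "X x \<in> K"
      using closed_sequentially[OF K(1) _ lim[OF that(1)]] that(2) by blast
    then have "(\<lambda>k. g (Xs k x)) \<longlonglongrightarrow> g (X x)"
      using that(2) continuous_on_tendsto_compose[OF g(1) lim[OF that(1)]] by simp
    then show ?thesis
      using that(2) \<open>X x \<in> K\<close> by (simp add: G_def)
  qed
  ultimately have "AE x in \<Omega>. (\<lambda>k. G (Xs k x)) \<longlonglongrightarrow> G (X x)"
    by (auto elim!: AE_mp)
  \<comment> \<open>Since \<open>G\<close> undoes \<open>s\<close>, decoding the law of the codes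
    returns the original law.\<close>
  moreover have "distr \<Omega> borel (\<lambda>x. G (Xs k x)) = P (r k)" for k
  proof -
    have "distr \<Omega> borel (\<lambda>x. G (Xs k x)) = distr (distr \<Omega> borel (Xs k)) borel G"
      by (subst distr_distr) (auto simp: comp_def)
    also have "\<dots> = distr (P (r k)) borel (\<lambda>z. z)"
      unfolding distr_Xs \<mu>_def by (subst distr_distr) (auto simp: comp_def G_s)
    also have "\<dots> = P (r k)"
      by (rule distr_id2) (simp add: setsP)
    finally show ?thesis .
  qed
  ultimately show thesis
    by (intro that[OF r \<Omega>, of "\<lambda>k x. G (Xs k x)" "\<lambda>x. G (X x)"]) auto
qed

section \<open>Continuous test functions determine Borel probability measures\<close>

text \<open>Closed sets form an intersection-stable generator of the Borel sets, and the indicator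
  of a nonempty closed \<open>C\<close> is the pointwise limit of the continuous functions
  \<open>max 0 (1 - n * infdist x C)\<close>, which take values in \<open>[0, 1]\<close>.\<close>

lemma prob_measure_eqI_continuous:
  fixes M N :: "'a::metric_space measure"
  assumes M: "M \<in> space (prob_algebra borel)" and N: "N \<in> space (prob_algebra borel)"
    and eq: "\<And>f :: 'a \<Rightarrow> real. continuous_on UNIV f \<Longrightarrow> (\<And>x. \<bar>f x\<bar> \<le> 1) \<Longrightarrow>
      (\<integral>x. f x \<partial>M) = (\<integral>x. f x \<partial>N)"
  shows "M = N"
proof (rule measure_eqI_generator_eq[where E = "Collect closed" and \<Omega> = UNIV and A = "\<lambda>_. UNIV"])
  \<comment> \<open>The empty set is excluded because \<open>infdist x {} = 0\<close> by convention,
    which would make these functions constantly 1.\<close>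
  have lim: "(\<lambda>n. \<integral>x. max 0 (1 - real n * infdist x C) \<partial>L) \<longlonglongrightarrow> measure L C"
    if L: "L \<in> space (prob_algebra borel)" and C: "closed C" "C \<noteq> {}" for L :: "'a measure" and C
  proof -
    interpret L: prob_space L
      using L by (simp add: space_prob_algebra)
    have sets[measurable_cong]: "sets L = sets borel"
      using L by (simp add: space_prob_algebra)
    have [measurable]: "C \<in> sets borel"
      using C by auto
    have [measurable]: "(\<lambda>x. infdist x C) \<in> borel_measurable borel"
      by (intro borel_measurable_continuous_onI continuous_intros)
    have "(\<lambda>n. \<integral>x. max 0 (1 - real n * infdist x C) \<partial>L) \<longlonglongrightarrow> (\<integral>x. indicator C x \<partial>L)"
    proof (rule integral_dominated_convergence[where w = "\<lambda>_. 1"])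
      show "AE x in L. (\<lambda>n. max 0 (1 - real n * infdist x C)) \<longlonglongrightarrow> indicator C x"
      proof (rule AE_I2)
        fix x
        show "(\<lambda>n. max 0 (1 - real n * infdist x C)) \<longlonglongrightarrow> indicator C x"
        proof (cases "x \<in> C")
          case False
          then have pos: "infdist x C > 0"
            using C infdist_pos_not_in_closed by blast
          obtain m where m: "1 < real m * infdist x C"
            using reals_Archimedean3[OF pos] by blast
          have "1 \<le> real n * infdist x C" if "n \<ge> m" for n
          proof -
            have "real m * infdist x C \<le> real n * infdist x C"
              using that pos by (intro mult_right_mono) auto
            then show ?thesis
              using m by simp
          qed
          then have "\<forall>\<^sub>F n in sequentially. max 0 (1 - real n * infdist x C) = indicator C x"
            using False unfolding eventually_sequentially by (intro exI[of _ m]) auto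
          then show ?thesis
            by (rule tendsto_eventually)
        qed simp
      qed
      show "AE x in L. norm (max 0 (1 - real n * infdist x C)) \<le> 1" for n
        by (intro AE_I2) (auto simp: infdist_nonneg)
    qed (auto simp del: max.bounded_iff)
    then show ?thesis
      by simp
  qed
  have sets: "sets M = sets borel" "sets N = sets borel"
    and prob: "prob_space M" "prob_space N"
    using M N by (auto simp: space_prob_algebra)
  then interpret M: prob_space M + N: prob_space N by simp_all
  fix C :: "'a set" assume "C \<in> Collect closed"
  then have C: "closed C" by simp
  show "emeasure M C = emeasure N C"
  proof (cases "C = {}")
    case False
    have "(\<integral>x. max 0 (1 - real n * infdist x C) \<partial>M) = (\<integral>x. max 0 (1 - real n * infdist x C) \<partial>N)" for n
      by (rule eq) (auto intro!: continuous_intros simp: infdist_nonneg)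
    then have "measure M C = measure N C"
      using lim[OF M C False] lim[OF N C False] LIMSEQ_unique by simp
    then show ?thesis
      by (simp add: M.emeasure_eq_measure N.emeasure_eq_measure)
  qed simp
next
  show "sets M = sigma_sets UNIV (Collect closed)" "sets N = sigma_sets UNIV (Collect closed)"
    using M N by (auto simp: space_prob_algebra borel_eq_closed)
  show "emeasure M UNIV \<noteq> \<infinity>"
    using M prob_space.emeasure_le_1[of M UNIV]
    by (auto simp: space_prob_algebra top_unique)
qed (auto simp: Int_stable_def)

section \<open>Discretization of transport plans\<close>

lemma sets_prob_algebra_borel: "M \<in> space (prob_algebra borel) \<Longrightarrow> sets M = sets borel"
  by (simp add: space_prob_algebra)

lemma space_prob_algebra_borel: "M \<in> space (prob_algebra borel) \<Longrightarrow> space M = UNIV"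
  using sets_eq_imp_space_eq[OF sets_prob_algebra_borel] by simp

lemma measurable_prob_algebra_borel:
  "M \<in> space (prob_algebra borel) \<Longrightarrow> g \<in> borel \<rightarrow>\<^sub>M N \<Longrightarrow> g \<in> M \<rightarrow>\<^sub>M N"
  by (simp add: sets_prob_algebra_borel cong: measurable_cong_sets)

lemma continuous_compact_bounded:
  fixes f :: "'a::metric_space \<Rightarrow> real"
  assumes "compact (UNIV :: 'a set)" "continuous_on UNIV f"
  shows "\<exists>b. \<forall>x. \<bar>f x\<bar> \<le> b"
proof -
  have "bounded (range f)"
    using assms by (intro compact_imp_bounded compact_continuous_image)
  then show ?thesis
    unfolding bounded_iff by auto
qed

lemma compact_UNIV_prod:
  assumes "compact (UNIV :: 'a::topological_space set)" "compact (UNIV :: 'b::topological_space set)"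
  shows "compact (UNIV :: ('a \<times> 'b) set)"
  using compact_Times[OF assms] by simp

lemma sets_borel_prod:
  "sets (borel \<Otimes>\<^sub>M borel) =
    sets (borel :: ('a::second_countable_topology \<times> 'b::second_countable_topology) measure)"
  unfolding borel_prod by (rule refl)

lemma h_partitionE:
  assumes "h_partition h S"
  obtains i where "i \<in> index S" "x \<in> cell S i"
  using assms unfolding h_partition_def by blast

lemma h_partition_cell_unique:
  "h_partition h S \<Longrightarrow> i \<in> index S \<Longrightarrow> i' \<in> index S \<Longrightarrow> x \<in> cell S i \<Longrightarrow> x \<in> cell S i' \<Longrightarrow> i' = i"
  unfolding h_partition_def disjoint_family_on_def by blast

lemma h_partition_measurable: "h_partition h S \<Longrightarrow> i \<in> index S \<Longrightarrow> cell S i \<in> sets borel"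
  by (simp add: h_partition_def)

lemma h_partition_dist_tag:
  assumes "h_partition h S" "i \<in> index S" "x \<in> cell S i"
  shows "dist x (tag S i) \<le> h"
proof -
  have cell: "bounded (cell S i)" "tag S i \<in> cell S i" "diameter (cell S i) \<le> h"
    using assms unfolding h_partition_def by blast+
  have "dist x (tag S i) \<le> diameter (cell S i)"
    using cell(1) assms(3) cell(2) by (rule diameter_bounded_bound)
  also note cell(3)
  finally show ?thesis .
qed

lemma sum_indicator_h_partition:
  fixes f :: "'i \<Rightarrow> 'c::{comm_semiring_1}"
  assumes S: "h_partition h S" and i: "i \<in> index S" "x \<in> cell S i"
  shows "(\<Sum>i\<in>index S. indicator (cell S i) x * f i) = f i"
proof -
  have "(\<Sum>i'\<in>index S. indicator (cell S i') x * f i') = (\<Sum>i'\<in>{i}. indicator (cell S i') x * f i')"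
  proof (intro sum.mono_neutral_right ballI)
    show "finite (index S)"
      using S by (simp add: h_partition_def)
    show "indicator (cell S i') x * f i' = 0" if "i' \<in> index S - {i}" for i'
      using that h_partition_cell_unique[OF S i(1) _ i(2), of i'] by (auto simp: indicator_def)
  qed (use i in simp)
  then show ?thesis
    using i(2) by simp
qed

text \<open>The map \<open>g\<close> lets one lemma serve several uses: \<open>fst\<close> and
  \<open>snd\<close> give the row and column sums of a transport plan, the identity gives additivity
  over the cells themselves.\<close>

lemma sum_measure_h_partition:
  assumes S: "h_partition h S" and M: "M \<in> space (prob_algebra borel)" and g: "g \<in> M \<rightarrow>\<^sub>M borel"
    and A: "A \<in> sets M"
  shows "(\<Sum>i\<in>index S. measure M (A \<inter> g -` cell S i)) = measure M A"
proof -
  interpret prob_space M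
    using M by (simp add: space_prob_algebra)
  have "measure M (\<Union>i\<in>index S. A \<inter> g -` cell S i) = (\<Sum>i\<in>index S. measure M (A \<inter> g -` cell S i))"
  proof (rule finite_measure_finite_Union)
    show "(\<lambda>i. A \<inter> g -` cell S i) ` index S \<subseteq> sets M"
    proof safe
      fix i assume i: "i \<in> index S"
      have "A \<inter> (g -` cell S i \<inter> space M) \<in> sets M"
        using A measurable_sets[OF g h_partition_measurable[OF S i]] by blast
      then show "A \<inter> g -` cell S i \<in> sets M"
        using sets.sets_into_space[OF A] by (simp add: Int_absorb2 Int_assoc[symmetric] inf.absorb1 le_infI1)
    qed
  qed (use S in \<open>auto simp: h_partition_def disjoint_family_on_def\<close>)
  moreover have "(\<Union>i\<in>index S. A \<inter> g -` cell S i) = A"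
    using h_partitionE[OF S] by blast
  ultimately show ?thesis
    by simp
qed

section \<open>Passing between transport plans and h-plans\<close>

text \<open>For fixed \<open>i\<close> the rectangles over all \<open>j\<close> partition the strip
  above \<open>cell S i\<close>, and the first marginal gives this strip its mass; columns are
  symmetric.\<close>

lemma h_plan_transport_plan:
  fixes \<mu> :: "'a::polish_space measure" and \<nu> :: "'b::polish_space measure"
  assumes \<pi>: "\<pi> \<in> transport_plans \<mu> \<nu>" and S: "h_partition h S" and T: "h_partition h T"
  shows "h_plan \<mu> \<nu> h S T (\<lambda>i j. measure \<pi> (cell S i \<times> cell T j))"
proof -
  have prob: "\<pi> \<in> space (prob_algebra borel)" and \<mu>: "distr \<pi> borel fst = \<mu>" and \<nu>: "distr \<pi> borel snd = \<nu>"
    using \<pi> by (auto simp: transport_plans_def)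
  note [measurable_cong] = sets_prob_algebra_borel[OF prob]
  have fst[measurable]: "fst \<in> \<pi> \<rightarrow>\<^sub>M borel" and snd[measurable]: "snd \<in> \<pi> \<rightarrow>\<^sub>M borel"
    unfolding borel_prod[symmetric] measurable_cong_sets[OF sets_prob_algebra_borel[OF prob] refl] by auto
  note sp = space_prob_algebra_borel[OF prob]
  have "(\<Sum>j\<in>index T. measure \<pi> (cell S i \<times> cell T j)) = measure \<mu> (cell S i)" if "i \<in> index S" for i
  proof -
    note [measurable] = h_partition_measurable[OF S that]
    have "(\<Sum>j\<in>index T. measure \<pi> (cell S i \<times> cell T j)) =
        (\<Sum>j\<in>index T. measure \<pi> ((fst -` cell S i \<inter> space \<pi>) \<inter> snd -` cell T j))"
      by (intro sum.cong arg_cong[where f = "measure _"]) (auto simp: sp)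
    also have "\<dots> = measure \<pi> (fst -` cell S i \<inter> space \<pi>)"
      by (rule sum_measure_h_partition[OF T prob snd]) measurable
    finally show ?thesis
      unfolding \<mu>[symmetric] by (simp add: measure_distr)
  qed
  moreover have "(\<Sum>i\<in>index S. measure \<pi> (cell S i \<times> cell T j)) = measure \<nu> (cell T j)" if "j \<in> index T" for j
  proof -
    note [measurable] = h_partition_measurable[OF T that]
    have "(\<Sum>i\<in>index S. measure \<pi> (cell S i \<times> cell T j)) =
        (\<Sum>i\<in>index S. measure \<pi> ((snd -` cell T j \<inter> space \<pi>) \<inter> fst -` cell S i))"
      by (intro sum.cong arg_cong[where f = "measure _"]) (auto simp: sp)
    also have "\<dots> = measure \<pi> (snd -` cell T j \<inter> space \<pi>)"
      by (rule sum_measure_h_partition[OF S prob fst]) measurable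
    finally show ?thesis
      unfolding \<nu>[symmetric] by (simp add: measure_distr)
  qed
  ultimately show ?thesis
    using S T by (simp add: h_plan_def)
qed

text \<open>Nonnegative entries of a row or column with sum 0 vanish. This makes division by the
  cell masses harmless when mass is spread over the cells.\<close>

lemma h_plan_zero:
  assumes "h_plan \<mu> \<nu> h S T w" "i \<in> index S" "j \<in> index T"
    and "measure \<mu> (cell S i) = 0 \<or> measure \<nu> (cell T j) = 0"
  shows "w i j = 0"
proof -
  have fin: "finite (index S)" "finite (index T)"
    using assms(1) by (auto simp: h_plan_def h_partition_def)
  have nn: "\<And>i j. i \<in> index S \<Longrightarrow> j \<in> index T \<Longrightarrow> 0 \<le> w i j"
    using assms(1) by (auto simp: h_plan_def)
  have "(\<Sum>j\<in>index T. w i j) = 0 \<or> (\<Sum>i\<in>index S. w i j) = 0"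
    using assms by (auto simp: h_plan_def)
  then show ?thesis
    using fin nn assms(2,3) by (auto simp: sum_nonneg_eq_0_iff)
qed

text \<open>On each cell \<open>E\<^sub>i \<times> F\<^sub>j\<close> the mass \<open>w i j\<close> is spread proportionally to \<open>\<mu> \<otimes> \<nu>\<close>. Where
  \<open>\<mu> E\<^sub>i = 0\<close> or \<open>\<nu> F\<^sub>j = 0\<close> the quotient below is the junk value \<open>0\<close>, which is right because then
  \<open>w i j = 0\<close>.\<close>

lemma h_plan_spread:
  fixes \<mu> :: "'a::polish_space measure" and \<nu> :: "'b::polish_space measure"
  assumes \<mu>: "\<mu> \<in> space (prob_algebra borel)" and \<nu>: "\<nu> \<in> space (prob_algebra borel)"
    and w: "h_plan \<mu> \<nu> h S T w"
  obtains \<pi> where "\<pi> \<in> transport_plans \<mu> \<nu>"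
    "\<And>i j. i \<in> index S \<Longrightarrow> j \<in> index T \<Longrightarrow> measure \<pi> (cell S i \<times> cell T j) = w i j"
proof -
  note [measurable_cong] = sets_prob_algebra_borel[OF \<mu>] sets_prob_algebra_borel[OF \<nu>]
  interpret \<mu>: prob_space \<mu>
    using \<mu> by (simp add: space_prob_algebra)
  interpret \<nu>: prob_space \<nu>
    using \<nu> by (simp add: space_prob_algebra)
  have S: "h_partition h S" and T: "h_partition h T"
    using w by (auto simp: h_plan_def)
  have fin[simp]: "finite (index S)" "finite (index T)"
    using S T by (auto simp: h_partition_def)
  have nn: "\<And>i j. i \<in> index S \<Longrightarrow> j \<in> index T \<Longrightarrow> 0 \<le> w i j"
    using w by (auto simp: h_plan_def)
  note [measurable] = h_partition_measurable[OF S] h_partition_measurable[OF T]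
  define m where "m i = measure \<mu> (cell S i)" for i
  define n where "n j = measure \<nu> (cell T j)" for j
  have row: "i \<in> index S \<Longrightarrow> (\<Sum>j\<in>index T. w i j) = m i"
    and col: "j \<in> index T \<Longrightarrow> (\<Sum>i\<in>index S. w i j) = n j" for i j
    using w by (auto simp: h_plan_def m_def n_def)
  have zero: "i \<in> index S \<Longrightarrow> j \<in> index T \<Longrightarrow> m i = 0 \<or> n j = 0 \<Longrightarrow> w i j = 0" for i j
    using h_plan_zero[OF w] by (simp add: m_def n_def)
  define f where "f = (\<lambda>z. \<Sum>i\<in>index S. \<Sum>j\<in>index T.
    ennreal (w i j / (m i * n j)) * indicator (cell S i \<times> cell T j) z)"
  define \<pi> where "\<pi> = density (\<mu> \<Otimes>\<^sub>M \<nu>) f"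
  have sets: "sets (\<mu> \<Otimes>\<^sub>M \<nu>) = sets borel"
    using sets_pair_measure_cong[OF sets_prob_algebra_borel[OF \<mu>] sets_prob_algebra_borel[OF \<nu>]]
    unfolding sets_borel_prod .
  have sets_\<pi>[measurable_cong]: "sets \<pi> = sets borel"
    by (simp add: \<pi>_def sets)
  have space_\<pi>: "space \<pi> = UNIV"
    using sets_eq_imp_space_eq[OF sets_\<pi>] by simp
  have [measurable]: "f \<in> borel_measurable (\<mu> \<Otimes>\<^sub>M \<nu>)"
    unfolding f_def by measurable
  \<comment> \<open>Everything below is read off from this formula: \<open>B = UNIV\<close> or
    \<open>A = UNIV\<close> gives the marginals, a pair of cells gives the masses
    \<open>w i j\<close>.\<close>
  have rect: "emeasure \<pi> (A \<times> B) = ennreal (\<Sum>i\<in>index S. \<Sum>j\<in>index T.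
      w i j / (m i * n j) * (measure \<mu> (A \<inter> cell S i) * measure \<nu> (B \<inter> cell T j)))"
    if [measurable]: "A \<in> sets borel" "B \<in> sets borel" for A B
  proof -
    have "emeasure \<pi> (A \<times> B) = (\<integral>\<^sup>+z. f z * indicator (A \<times> B) z \<partial>(\<mu> \<Otimes>\<^sub>M \<nu>))"
      unfolding \<pi>_def by (rule emeasure_density) measurable
    also have "\<dots> = (\<integral>\<^sup>+z. (\<Sum>i\<in>index S. \<Sum>j\<in>index T. ennreal (w i j / (m i * n j)) *
        indicator ((A \<inter> cell S i) \<times> (B \<inter> cell T j)) z) \<partial>(\<mu> \<Otimes>\<^sub>M \<nu>))"
      unfolding f_def sum_distrib_right
      by (intro nn_integral_cong sum.cong) (auto simp: indicator_def)
    also have "\<dots> = (\<Sum>i\<in>index S. \<integral>\<^sup>+z. (\<Sum>j\<in>index T. ennreal (w i j / (m i * n j)) *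
        indicator ((A \<inter> cell S i) \<times> (B \<inter> cell T j)) z) \<partial>(\<mu> \<Otimes>\<^sub>M \<nu>))"
      by (rule nn_integral_sum) measurable
    also have "\<dots> = (\<Sum>i\<in>index S. \<Sum>j\<in>index T. \<integral>\<^sup>+z. ennreal (w i j / (m i * n j)) *
        indicator ((A \<inter> cell S i) \<times> (B \<inter> cell T j)) z \<partial>(\<mu> \<Otimes>\<^sub>M \<nu>))"
      by (intro sum.cong refl nn_integral_sum) measurable
    also have "\<dots> = (\<Sum>i\<in>index S. \<Sum>j\<in>index T. ennreal (w i j / (m i * n j)) *
        emeasure (\<mu> \<Otimes>\<^sub>M \<nu>) ((A \<inter> cell S i) \<times> (B \<inter> cell T j)))"
      by (intro sum.cong refl nn_integral_cmult_indicator) measurable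
    also have "\<dots> = (\<Sum>i\<in>index S. \<Sum>j\<in>index T. ennreal (w i j / (m i * n j) *
        (measure \<mu> (A \<inter> cell S i) * measure \<nu> (B \<inter> cell T j))))"
    proof (intro sum.cong refl)
      fix i j assume ij: "i \<in> index S" "j \<in> index T"
      then have "emeasure (\<mu> \<Otimes>\<^sub>M \<nu>) ((A \<inter> cell S i) \<times> (B \<inter> cell T j)) =
          ennreal (measure \<mu> (A \<inter> cell S i) * measure \<nu> (B \<inter> cell T j))"
        by (subst \<nu>.emeasure_pair_measure_Times)
           (auto simp: \<mu>.emeasure_eq_measure \<nu>.emeasure_eq_measure ennreal_mult)
      moreover have "0 \<le> w i j / (m i * n j)"
        using nn[OF ij] by (simp add: m_def n_def)
      ultimately show "ennreal (w i j / (m i * n j)) *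
          emeasure (\<mu> \<Otimes>\<^sub>M \<nu>) ((A \<inter> cell S i) \<times> (B \<inter> cell T j)) =
          ennreal (w i j / (m i * n j) * (measure \<mu> (A \<inter> cell S i) * measure \<nu> (B \<inter> cell T j)))"
        by (simp only: ennreal_mult measure_nonneg mult_nonneg_nonneg)
    qed
    also have "\<dots> = ennreal (\<Sum>i\<in>index S. \<Sum>j\<in>index T. w i j / (m i * n j) *
        (measure \<mu> (A \<inter> cell S i) * measure \<nu> (B \<inter> cell T j)))"
      using nn by (simp add: sum_ennreal sum_nonneg m_def n_def)
    finally show ?thesis .
  qed
  have marg1: "emeasure \<pi> (A \<times> UNIV) = emeasure \<mu> A" if [measurable]: "A \<in> sets borel" for A
  proof -
    have "(\<Sum>j\<in>index T. w i j / (m i * n j) * (measure \<mu> (A \<inter> cell S i) * measure \<nu> (UNIV \<inter> cell T j))) =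
        measure \<mu> (A \<inter> cell S i)" if i: "i \<in> index S" for i
    proof -
      \<comment> \<open>The factor \<open>n j\<close> cancels; where \<open>n j = 0\<close> both
        sides vanish because \<open>w i j = 0\<close>.\<close>
      have "(\<Sum>j\<in>index T. w i j / (m i * n j) * (measure \<mu> (A \<inter> cell S i) * measure \<nu> (UNIV \<inter> cell T j))) =
          (\<Sum>j\<in>index T. w i j) * (measure \<mu> (A \<inter> cell S i) / m i)"
        unfolding sum_distrib_right
        by (intro sum.cong) (use zero[OF i] in \<open>auto simp: n_def\<close>)
      also have "\<dots> = measure \<mu> (A \<inter> cell S i)"
      proof (cases "m i = 0")
        \<comment> \<open>The quotient by \<open>m i\<close> is then 0 by convention, and the right
          side is 0 because it measures a subset of a null cell.\<close>
        case True
        have "measure \<mu> (A \<inter> cell S i) \<le> m i"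
          unfolding m_def using i by (intro \<mu>.finite_measure_mono) auto
        then show ?thesis
          using True by (simp add: measure_le_0_iff)
      qed (simp add: row[OF i])
      finally show ?thesis .
    qed
    then have "emeasure \<pi> (A \<times> UNIV) = ennreal (\<Sum>i\<in>index S. measure \<mu> (A \<inter> cell S i))"
      by (simp add: rect)
    also have "\<dots> = emeasure \<mu> A"
      using sum_measure_h_partition[OF S \<mu>, of "\<lambda>x. x" A] by (simp add: \<mu>.emeasure_eq_measure)
    finally show ?thesis .
  qed
  have marg2: "emeasure \<pi> (UNIV \<times> B) = emeasure \<nu> B" if [measurable]: "B \<in> sets borel" for B
  proof -
    have "(\<Sum>i\<in>index S. w i j / (m i * n j) * (measure \<mu> (UNIV \<inter> cell S i) * measure \<nu> (B \<inter> cell T j))) =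
        measure \<nu> (B \<inter> cell T j)" if j: "j \<in> index T" for j
    proof -
      have "(\<Sum>i\<in>index S. w i j / (m i * n j) * (measure \<mu> (UNIV \<inter> cell S i) * measure \<nu> (B \<inter> cell T j))) =
          (\<Sum>i\<in>index S. w i j) * (measure \<nu> (B \<inter> cell T j) / n j)"
        unfolding sum_distrib_right
        by (intro sum.cong) (use zero[OF _ j] in \<open>auto simp: m_def\<close>)
      also have "\<dots> = measure \<nu> (B \<inter> cell T j)"
      proof (cases "n j = 0")
        case True
        have "measure \<nu> (B \<inter> cell T j) \<le> n j"
          unfolding n_def using j by (intro \<nu>.finite_measure_mono) auto
        then show ?thesis
          using True by (simp add: measure_le_0_iff)
      qed (simp add: col[OF j])
      finally show ?thesis .
    qed
    then have "emeasure \<pi> (UNIV \<times> B) = ennreal (\<Sum>j\<in>index T. measure \<nu> (B \<inter> cell T j))"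
      by (subst rect, simp, simp, subst sum.swap) simp
    also have "\<dots> = emeasure \<nu> B"
      using sum_measure_h_partition[OF T \<nu>, of "\<lambda>x. x" B] by (simp add: \<nu>.emeasure_eq_measure)
    finally show ?thesis .
  qed
  have "prob_space \<pi>"
  proof
    show "emeasure \<pi> (space \<pi>) = 1"
      using marg1[of UNIV] \<mu>.emeasure_space_1 space_prob_algebra_borel[OF \<mu>]
      by (simp add: space_\<pi>)
  qed
  have fst[measurable]: "fst \<in> \<pi> \<rightarrow>\<^sub>M borel" and snd[measurable]: "snd \<in> \<pi> \<rightarrow>\<^sub>M borel"
    unfolding borel_prod[symmetric] measurable_cong_sets[OF sets_\<pi> refl] by auto
  have "distr \<pi> borel fst = \<mu>"
  proof (rule measure_eqI)
    fix A assume "A \<in> sets (distr \<pi> borel fst)"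
    then have A: "A \<in> sets borel" by simp
    have "fst -` A \<inter> space \<pi> = A \<times> UNIV"
      by (auto simp: space_\<pi>)
    then show "emeasure (distr \<pi> borel fst) A = emeasure \<mu> A"
      using A marg1 by (simp add: emeasure_distr)
  qed (simp add: sets_prob_algebra_borel[OF \<mu>])
  moreover have "distr \<pi> borel snd = \<nu>"
  proof (rule measure_eqI)
    fix B assume "B \<in> sets (distr \<pi> borel snd)"
    then have B: "B \<in> sets borel" by simp
    have "snd -` B \<inter> space \<pi> = UNIV \<times> B"
      by (auto simp: space_\<pi>)
    then show "emeasure (distr \<pi> borel snd) B = emeasure \<nu> B"
      using B marg2 by (simp add: emeasure_distr)
  qed (simp add: sets_prob_algebra_borel[OF \<nu>])
  ultimately have "\<pi> \<in> transport_plans \<mu> \<nu>"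
    using \<open>prob_space \<pi>\<close> sets_\<pi> by (simp add: transport_plans_def space_prob_algebra)
  moreover have "measure \<pi> (cell S i \<times> cell T j) = w i j" if ij: "i \<in> index S" "j \<in> index T" for i j
  proof -
    \<comment> \<open>Disjointness of the cells leaves a single term of the double sum in
      \<open>rect\<close>.\<close>
    have "cell S i \<inter> cell S i' = (if i' = i then cell S i else {})" if "i' \<in> index S" for i'
      using that ij S by (auto simp: h_partition_def disjoint_family_on_def)
    moreover have "cell T j \<inter> cell T j' = (if j' = j then cell T j else {})" if "j' \<in> index T" for j'
      using that ij T by (auto simp: h_partition_def disjoint_family_on_def)
    ultimately have "(\<Sum>i'\<in>index S. \<Sum>j'\<in>index T. w i' j' / (m i' * n j') *
        (measure \<mu> (cell S i \<inter> cell S i') * measure \<nu> (cell T j \<inter> cell T j'))) =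
        (\<Sum>i'\<in>index S. \<Sum>j'\<in>index T. if i' = i then if j' = j then w i j / (m i * n j) * (m i * n j) else 0 else 0)"
      by (intro sum.cong refl) (simp add: m_def n_def)
    also have "\<dots> = (\<Sum>i'\<in>index S. if i' = i then (\<Sum>j'\<in>index T. if j' = j then w i j / (m i * n j) * (m i * n j) else 0) else 0)"
      by (intro sum.cong refl) simp
    also have "\<dots> = w i j / (m i * n j) * (m i * n j)"
      using ij by simp
    also have "\<dots> = w i j"
      using zero[OF ij] by auto
    finally show ?thesis
      using ij nn[OF ij] by (simp add: measure_def rect)
  qed
  ultimately show thesis
    by (rule that)
qed

section \<open>The quantitative cost bound\<close>

text \<open>The discrete cost is the integral of a step function \<open>t\<close> against
  \<open>\<pi>\<close>, and \<open>t\<close> is uniformly within \<open>cost_modulus c h\<close> of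
  \<open>c\<close>. Only the masses of the rectangles link \<open>\<pi>\<close> and
  \<open>w\<close>, so the estimate serves both spreading and discretizing.\<close>

lemma transport_cost_discretization:
  fixes \<mu> :: "'a::polish_space measure" and \<nu> :: "'b::polish_space measure"
  assumes c: "compact_OT_problem \<mu> \<nu> c" and \<pi>: "\<pi> \<in> transport_plans \<mu> \<nu>"
    and S: "h_partition h S" and T: "h_partition h T" and "0 \<le> h"
    and w: "\<And>i j. i \<in> index S \<Longrightarrow> j \<in> index T \<Longrightarrow> measure \<pi> (cell S i \<times> cell T j) = w i j"
  shows "\<bar>transport_cost c (plan_measure S T w) - transport_cost c \<pi>\<bar> \<le> cost_modulus c h"
proof -
  have prob: "\<pi> \<in> space (prob_algebra borel)"
    using \<pi> by (auto simp: transport_plans_def)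
  note [measurable_cong] = sets_prob_algebra_borel[OF prob]
  interpret prob_space \<pi>
    using prob by (simp add: space_prob_algebra)
  have fin[simp]: "finite (index S)" "finite (index T)"
    using S T by (auto simp: h_partition_def)
  have rect: "cell S i \<times> cell T j \<in> sets \<pi>" if "i \<in> index S" "j \<in> index T" for i j
    using pair_measureI[OF h_partition_measurable[OF S that(1)] h_partition_measurable[OF T that(2)]]
    unfolding sets_borel_prod sets_prob_algebra_borel[OF prob] .
  have cont: "continuous_on UNIV c" and c_meas[measurable]: "c \<in> borel_measurable borel"
    using c by (auto simp: compact_OT_problem_def OT_problem_def)
  have "compact (UNIV :: ('a \<times> 'b) set)"
    using c by (intro compact_UNIV_prod) (auto simp: compact_OT_problem_def)
  then obtain b where b: "\<bar>c z\<bar> \<le> b" for z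
    using continuous_compact_bounded[OF _ cont] by blast
  define t where "t z = (\<Sum>i\<in>index S. \<Sum>j\<in>index T.
    c (tag S i, tag T j) * indicator (cell S i \<times> cell T j) z)" for z
  have t_close: "\<bar>t z - c z\<bar> \<le> cost_modulus c h" for z
  proof -
    obtain i where i: "i \<in> index S" "fst z \<in> cell S i"
      using h_partitionE[OF S] .
    obtain j where j: "j \<in> index T" "snd z \<in> cell T j"
      using h_partitionE[OF T] .
    have "t z = (\<Sum>i\<in>index S. indicator (cell S i) (fst z) *
        (\<Sum>j\<in>index T. indicator (cell T j) (snd z) * c (tag S i, tag T j)))"
      unfolding t_def sum_distrib_left by (intro sum.cong) (auto simp: indicator_def mem_Times_iff)
    also have "\<dots> = c (tag S i, tag T j)"
      unfolding sum_indicator_h_partition[OF T j] by (rule sum_indicator_h_partition[OF S i])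
    finally have "t z = c (tag S i, tag T j)" .
    \<comment> \<open>With the maximum metric the product cell has diameter at most
      \<open>h\<close>, with no factor lost.\<close>
    moreover have "max_dist (tag S i, tag T j) z \<le> h"
      using h_partition_dist_tag[OF S i] h_partition_dist_tag[OF T j]
      by (simp add: max_dist_def dist_commute)
    ultimately show ?thesis
      using cost_modulus_attained(2)[OF c \<open>0 \<le> h\<close>] by simp
  qed
  have int_tag: "integrable \<pi> (\<lambda>z. c (tag S i, tag T j) * indicator (cell S i \<times> cell T j) z)"
    if "i \<in> index S" "j \<in> index T" for i j
    using rect[OF that] by (intro integrable_mult_right integrable_real_indicator)
      (simp_all add: emeasure_eq_measure)
  have int_t: "integrable \<pi> t"
    unfolding t_def by (intro Bochner_Integration.integrable_sum int_tag)
  have int_c: "integrable \<pi> c"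
    using b by (intro integrable_const_bound[of _ b] AE_I2) simp_all
  have "transport_cost c (plan_measure S T w) =
      (\<Sum>i\<in>index S. \<Sum>j\<in>index T. w i j * c (tag S i, tag T j))"
    by (rule transport_cost_plan_measure[OF fin c_meas]) (metis w measure_nonneg)
  also have "\<dots> = (\<Sum>i\<in>index S. \<Sum>j\<in>index T. \<integral>z. c (tag S i, tag T j) * indicator (cell S i \<times> cell T j) z \<partial>\<pi>)"
  proof (intro sum.cong refl)
    fix i j assume ij: "i \<in> index S" "j \<in> index T"
    show "w i j * c (tag S i, tag T j) =
        (\<integral>z. c (tag S i, tag T j) * indicator (cell S i \<times> cell T j) z \<partial>\<pi>)"
      using w[OF ij] by (simp add: space_prob_algebra_borel[OF prob] mult.commute)
  qed
  also have "\<dots> = (\<Sum>i\<in>index S. \<integral>z. (\<Sum>j\<in>index T.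
      c (tag S i, tag T j) * indicator (cell S i \<times> cell T j) z) \<partial>\<pi>)"
    by (intro sum.cong refl Bochner_Integration.integral_sum[symmetric] int_tag)
  also have "\<dots> = (\<integral>z. t z \<partial>\<pi>)"
    unfolding t_def
    by (intro Bochner_Integration.integral_sum[symmetric] Bochner_Integration.integrable_sum int_tag)
  finally have "\<bar>transport_cost c (plan_measure S T w) - transport_cost c \<pi>\<bar> = \<bar>\<integral>z. t z - c z \<partial>\<pi>\<bar>"
    using int_t int_c by (simp add: transport_cost_def)
  also have "\<dots> \<le> (\<integral>z. \<bar>t z - c z\<bar> \<partial>\<pi>)"
    by (rule integral_abs_bound)
  also have "\<dots> \<le> (\<integral>z. cost_modulus c h \<partial>\<pi>)"
    using int_t int_c t_close by (intro integral_mono) auto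
  also have "\<dots> = cost_modulus c h"
    by (simp add: prob_space)
  finally show ?thesis .
qed

text \<open>Discretizing an arbitrary transport plan gives a competitor for \<open>w\<close>, which
  bounds the discrete cost from above. Spreading \<open>w\<close> gives a competitor in the
  Kantorovich problem, which bounds it from below.\<close>

lemma h_plan_cost_bound:
  fixes \<mu> :: "'a::polish_space measure" and \<nu> :: "'b::polish_space measure"
  assumes c: "compact_OT_problem \<mu> \<nu> c" and w: "eps_optimal_h_plan \<mu> \<nu> c \<epsilon> h S T w"
  shows "\<bar>transport_cost c (plan_measure S T w) - Kantorovich_value \<mu> \<nu> c\<bar> \<le> cost_modulus c h + \<epsilon>"
proof -
  have "0 \<le> \<epsilon>" "0 \<le> h" and plan: "h_plan \<mu> \<nu> h S T w"
    and opt: "\<And>w'. h_plan \<mu> \<nu> h S T w' \<Longrightarrow>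
      transport_cost c (plan_measure S T w) \<le> \<epsilon> + transport_cost c (plan_measure S T w')"
    using w unfolding eps_optimal_h_plan_def by blast+
  have S: "h_partition h S" and T: "h_partition h T"
    using plan by (auto simp: h_plan_def)
  have \<mu>: "\<mu> \<in> space (prob_algebra borel)" and \<nu>: "\<nu> \<in> space (prob_algebra borel)"
    using c by (auto simp: compact_OT_problem_def OT_problem_def)
  obtain \<pi> where \<pi>: "\<pi> \<in> transport_plans \<mu> \<nu>"
    and \<pi>_w: "\<And>i j. i \<in> index S \<Longrightarrow> j \<in> index T \<Longrightarrow> measure \<pi> (cell S i \<times> cell T j) = w i j"
    by (rule h_plan_spread[OF \<mu> \<nu> plan]) (rule that)
  \<comment> \<open>Besides the estimate itself, this shows that the costs are bounded below, so the
    infimum is a genuine one.\<close>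
  have lower: "transport_cost c (plan_measure S T w) - \<epsilon> - cost_modulus c h \<le> transport_cost c \<pi>'"
    if "\<pi>' \<in> transport_plans \<mu> \<nu>" for \<pi>'
    using opt[OF h_plan_transport_plan[OF that S T]]
      transport_cost_discretization[OF c that S T \<open>0 \<le> h\<close> refl] by linarith
  have "transport_cost c (plan_measure S T w) - \<epsilon> - cost_modulus c h \<le> Kantorovich_value \<mu> \<nu> c"
    unfolding Kantorovich_value_def using \<pi> by (intro cINF_greatest lower) blast
  moreover have "Kantorovich_value \<mu> \<nu> c \<le> transport_cost c \<pi>"
    unfolding Kantorovich_value_def by (rule cINF_lower[OF bdd_belowI2[OF lower] \<pi>])
  moreover have "\<bar>transport_cost c (plan_measure S T w) - transport_cost c \<pi>\<bar> \<le> cost_modulus c h"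
    by (rule transport_cost_discretization[OF c \<pi> S T \<open>0 \<le> h\<close> \<pi>_w])
  ultimately show ?thesis
    using \<open>0 \<le> \<epsilon>\<close> by linarith
qed

lemma cost_modulus_tendsto_0:
  fixes \<mu> :: "'a::polish_space measure" and \<nu> :: "'b::polish_space measure"
  assumes c: "compact_OT_problem \<mu> \<nu> c" and "\<And>k. 0 \<le> h k" "h \<longlonglongrightarrow> 0"
  shows "(\<lambda>k. cost_modulus c (h k)) \<longlonglongrightarrow> 0"
proof (rule LIMSEQ_I)
  fix e :: real assume "0 < e"
  have "compact (UNIV :: ('a \<times> 'b) set)"
    using c by (intro compact_UNIV_prod) (auto simp: compact_OT_problem_def)
  then have "uniformly_continuous_on UNIV c"
    using c by (intro compact_uniformly_continuous) (auto simp: compact_OT_problem_def)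
  then obtain d where "d > 0" and d: "\<And>z z'. dist z' z < d \<Longrightarrow> dist (c z') (c z) < e"
    using \<open>0 < e\<close> by (auto simp: uniformly_continuous_on_def)
  \<comment> \<open>Uniform continuity refers to the Euclidean product metric, which is at most the
    sum of the coordinate distances and so at most \<open>2 * h k\<close>; hence the half.\<close>
  obtain N where N: "\<And>k. k \<ge> N \<Longrightarrow> \<bar>h k\<bar> < d / 2"
    using LIMSEQ_D[OF assms(3), of "d / 2"] \<open>d > 0\<close> by auto
  have "norm (cost_modulus c (h k) - 0) < e" if "k \<ge> N" for k
  proof -
    obtain z z' where z: "max_dist z z' \<le> h k" "cost_modulus c (h k) = \<bar>c z - c z'\<bar>"
      using cost_modulus_attained(1)[OF c assms(2)] by blast
    have "dist z z' \<le> dist (fst z) (fst z') + dist (snd z) (snd z')"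
      unfolding dist_prod_def by (rule sqrt_sum_squares_le_sum) auto
    also have "\<dots> \<le> h k + h k"
      using z(1) by (intro add_mono) (auto simp: max_dist_def)
    also have "\<dots> < d"
      using N[OF that] by linarith
    finally show ?thesis
      using d[of z z'] z(2) by (simp add: dist_real_def)
  qed
  then show "\<exists>N. \<forall>k\<ge>N. norm (cost_modulus c (h k) - 0) < e"
    by blast
qed

section \<open>Approximating sequences\<close>

lemma plan_measure_prob:
  fixes \<mu> :: "'a::polish_space measure" and \<nu> :: "'b::polish_space measure"
  assumes \<mu>: "\<mu> \<in> space (prob_algebra borel)" and w: "h_plan \<mu> \<nu> h S T w"
  shows "plan_measure S T w \<in> space (prob_algebra borel)"
proof -
  interpret \<mu>: prob_space \<mu>
    using \<mu> by (simp add: space_prob_algebra)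
  have S: "h_partition h S" and T: "h_partition h T"
    using w by (auto simp: h_plan_def)
  have fin: "finite (index S)" "finite (index T)"
    using S T by (auto simp: h_partition_def)
  have nn: "\<And>i j. i \<in> index S \<Longrightarrow> j \<in> index T \<Longrightarrow> 0 \<le> w i j"
    using w by (auto simp: h_plan_def)
  have sets: "sets (plan_measure S T w) = sets borel"
    by (simp add: plan_measure_def)
  have "emeasure (plan_measure S T w) UNIV = (\<Sum>i\<in>index S. \<Sum>j\<in>index T. ennreal (w i j))"
    by (simp add: emeasure_plan_measure[OF fin])
  also have "\<dots> = ennreal (\<Sum>i\<in>index S. \<Sum>j\<in>index T. w i j)"
    using nn by (simp add: sum_ennreal sum_nonneg)
  also have "(\<Sum>i\<in>index S. \<Sum>j\<in>index T. w i j) = (\<Sum>i\<in>index S. measure \<mu> (cell S i))"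
    using w by (intro sum.cong refl) (simp add: h_plan_def)
  also have "\<dots> = measure \<mu> UNIV"
    using sum_measure_h_partition[OF S \<mu>, of "\<lambda>x. x" UNIV]
    by (simp add: sets_prob_algebra_borel[OF \<mu>] measurable_ident_sets)
  also have "\<dots> = 1"
    using \<mu>.prob_space by (simp add: space_prob_algebra_borel[OF \<mu>])
  finally have "emeasure (plan_measure S T w) (space (plan_measure S T w)) = 1"
    using sets_eq_imp_space_eq[OF sets] by simp
  then show ?thesis
    using sets by (auto simp: space_prob_algebra intro: prob_spaceI)
qed

section \<open>From almost sure convergence to weak and Wasserstein convergence\<close>

lemma integral_distr_tendsto:
  fixes f :: "'z::metric_space \<Rightarrow> real"
  assumes "compact (UNIV :: 'z set)" and f: "continuous_on UNIV f" and "prob_space \<Omega>"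
    and [measurable]: "\<And>k. X k \<in> borel_measurable \<Omega>" "Y \<in> borel_measurable \<Omega>"
    and lim: "AE \<omega> in \<Omega>. (\<lambda>k. X k \<omega>) \<longlonglongrightarrow> Y \<omega>"
  shows "(\<lambda>k. \<integral>z. f z \<partial>distr \<Omega> borel (X k)) \<longlonglongrightarrow> (\<integral>z. f z \<partial>distr \<Omega> borel Y)"
proof -
  interpret prob_space \<Omega> by fact
  have [measurable]: "f \<in> borel_measurable borel"
    using f by (rule borel_measurable_continuous_onI)
  obtain b where b: "\<And>x. \<bar>f x\<bar> \<le> b"
    using continuous_compact_bounded[OF assms(1) f] by blast
  have "(\<lambda>k. \<integral>\<omega>. f (X k \<omega>) \<partial>\<Omega>) \<longlonglongrightarrow> (\<integral>\<omega>. f (Y \<omega>) \<partial>\<Omega>)"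
  proof (rule integral_dominated_convergence[where w = "\<lambda>_. b"])
    show "AE \<omega> in \<Omega>. (\<lambda>k. f (X k \<omega>)) \<longlonglongrightarrow> f (Y \<omega>)"
      using lim by eventually_elim (rule continuous_on_tendsto_compose[OF f], auto)
  qed (use b in auto)
  then show ?thesis
    by (simp add: integral_distr)
qed

text \<open>A finite cost \<open>D\<close> of one coupling keeps the infimum out of the infinite
  branch of \<open>ennreal_powr\<close>, so monotonicity of the real power applies.\<close>

lemma wasserstein_le_coupling:
  assumes \<gamma>: "\<gamma> \<in> transport_plans P Q" and "1 \<le> p" "0 \<le> D"
    and D: "(\<integral>\<^sup>+z. ennreal (d (fst z) (snd z) powr p) \<partial>\<gamma>) = ennreal D"
  shows "wasserstein d p P Q \<le> ennreal (D powr (1 / p))"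
proof -
  define I where "I = (INF \<gamma>\<in>transport_plans P Q. \<integral>\<^sup>+z. ennreal (d (fst z) (snd z) powr p) \<partial>\<gamma>)"
  have le: "I \<le> ennreal D"
    unfolding I_def D[symmetric] by (rule INF_lower[OF \<gamma>])
  then have "I \<noteq> \<top>"
    by (rule neq_top_trans[OF ennreal_neq_top])
  moreover have "enn2real I \<le> D"
    using le \<open>0 \<le> D\<close> by (rule enn2real_leI[rotated])
  then have "enn2real I powr (1 / p) \<le> D powr (1 / p)"
    using \<open>1 \<le> p\<close> by (intro powr_mono2) auto
  ultimately show ?thesis
    unfolding wasserstein_def I_def[symmetric] by (simp add: ennreal_powr_def ennreal_leI)
qed

text \<open>The joint law of \<open>X k\<close> and \<open>Y\<close> is a coupling whose cost is the
  expectation \<open>D k\<close> of the p-th power of their distance. Compactness bounds this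
  distance, so dominated convergence applies.\<close>

lemma wasserstein_tendsto_0:
  fixes X :: "nat \<Rightarrow> 'o \<Rightarrow> 'a::polish_space \<times> 'b::polish_space"
  assumes cpt: "compact (UNIV :: 'a set)" "compact (UNIV :: 'b set)" and "prob_space \<Omega>"
    and [measurable]: "\<And>k. X k \<in> borel_measurable \<Omega>" "Y \<in> borel_measurable \<Omega>"
    and lim: "AE \<omega> in \<Omega>. (\<lambda>k. X k \<omega>) \<longlonglongrightarrow> Y \<omega>" and "1 \<le> p"
  shows "(\<lambda>k. wasserstein max_dist p (distr \<Omega> borel (X k)) (distr \<Omega> borel Y)) \<longlonglongrightarrow> 0"
proof -
  interpret prob_space \<Omega> by fact
  let ?d = "\<lambda>z :: ('a \<times> 'b) \<times> ('a \<times> 'b). max_dist (fst z) (snd z)"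
  have cont: "continuous_on UNIV ?d"
    unfolding max_dist_def by (intro continuous_intros)
  have [measurable]: "?d \<in> borel_measurable borel"
    using cont by (rule borel_measurable_continuous_onI)
  have nonneg: "0 \<le> max_dist z z'" for z z' :: "'a \<times> 'b"
    by (simp add: max_dist_def le_max_iff_disj)
  have pair[measurable]: "(\<lambda>\<omega>. (X k \<omega>, Y \<omega>)) \<in> borel_measurable \<Omega>" for k
    by (rule borel_measurable_Pair) measurable
  have d_meas[measurable]: "(\<lambda>\<omega>. max_dist (X k \<omega>) (Y \<omega>)) \<in> borel_measurable \<Omega>" for k
    using measurable_compose[OF pair \<open>?d \<in> borel_measurable borel\<close>] by simp
  have "compact (UNIV :: (('a \<times> 'b) \<times> ('a \<times> 'b)) set)"
    using cpt by (intro compact_UNIV_prod)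
  then obtain b where b': "\<And>z. \<bar>?d z\<bar> \<le> b"
    using continuous_compact_bounded[OF _ cont] by blast
  have b: "max_dist z z' \<le> b" for z z' :: "'a \<times> 'b"
    using b'[of "(z, z')"] by simp
  have b_powr: "max_dist z z' powr p \<le> b powr p" for z z' :: "'a \<times> 'b"
    using b nonneg \<open>1 \<le> p\<close> by (intro powr_mono2) auto
  define D where "D k = (\<integral>\<omega>. max_dist (X k \<omega>) (Y \<omega>) powr p \<partial>\<Omega>)" for k
  have "D \<longlonglongrightarrow> (\<integral>\<omega>. 0 \<partial>\<Omega>)"
    unfolding D_def
  proof (rule integral_dominated_convergence[where w = "\<lambda>_. b powr p"])
    show "AE \<omega> in \<Omega>. (\<lambda>k. max_dist (X k \<omega>) (Y \<omega>) powr p) \<longlonglongrightarrow> 0"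
      using lim
    proof eventually_elim
      case (elim \<omega>)
      \<comment> \<open>The limit is 0, left unevaluated so that it has the shape which the limit
        rules produce.\<close>
      then have "(\<lambda>k. max_dist (X k \<omega>) (Y \<omega>)) \<longlonglongrightarrow>
          max (dist (fst (Y \<omega>)) (fst (Y \<omega>))) (dist (snd (Y \<omega>)) (snd (Y \<omega>)))"
        unfolding max_dist_def by (intro tendsto_intros)
      \<comment> \<open>At base 0 continuity of the power rests on a positive exponent and
        nonnegative bases.\<close>
      then have "(\<lambda>k. max_dist (X k \<omega>) (Y \<omega>) powr p) \<longlonglongrightarrow> 0 powr p"
        using nonneg \<open>1 \<le> p\<close> by (intro tendsto_powr') auto
      then show ?case
        by simp
    qed
    show "AE \<omega> in \<Omega>. norm (max_dist (X k \<omega>) (Y \<omega>) powr p) \<le> b powr p" for k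
      by (rule AE_I2) (simp only: real_norm_def abs_of_nonneg[OF powr_ge_zero] b_powr)
    show "integrable \<Omega> (\<lambda>_. b powr p)"
      by simp
    show "(\<lambda>\<omega>. max_dist (X k \<omega>) (Y \<omega>) powr p) \<in> borel_measurable \<Omega>" for k
      by measurable
  qed simp
  then have "D \<longlonglongrightarrow> 0"
    by simp
  moreover have D_nonneg: "0 \<le> D k" for k
    unfolding D_def by simp
  ultimately have "(\<lambda>k. D k powr (1 / p)) \<longlonglongrightarrow> 0 powr (1 / p)"
    using \<open>1 \<le> p\<close> by (intro tendsto_powr') auto
  then have upper: "(\<lambda>k. ennreal (D k powr (1 / p))) \<longlonglongrightarrow> 0"
    using tendsto_ennrealI[of _ 0] by simp
  have bound: "wasserstein max_dist p (distr \<Omega> borel (X k)) (distr \<Omega> borel Y) \<le> ennreal (D k powr (1 / p))" for k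
  proof (rule wasserstein_le_coupling[OF _ \<open>1 \<le> p\<close> D_nonneg])
    let ?\<gamma> = "distr \<Omega> borel (\<lambda>\<omega>. (X k \<omega>, Y \<omega>))"
    have [measurable]: "fst \<in> borel_measurable (borel :: (('a \<times> 'b) \<times> ('a \<times> 'b)) measure)"
      "snd \<in> borel_measurable (borel :: (('a \<times> 'b) \<times> ('a \<times> 'b)) measure)"
      by (rule borel_measurable_continuous_onI, intro continuous_intros)+
    have integrand: "(\<lambda>z. ennreal (?d z powr p)) \<in> borel_measurable ?\<gamma>"
      by measurable
    have "prob_space ?\<gamma>"
      by (rule prob_space_distr) measurable
    then show "?\<gamma> \<in> transport_plans (distr \<Omega> borel (X k)) (distr \<Omega> borel Y)"
      by (simp add: transport_plans_def space_prob_algebra distr_distr comp_def)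
    have "(\<integral>\<^sup>+z. ennreal (max_dist (fst z) (snd z) powr p) \<partial>?\<gamma>) =
        (\<integral>\<^sup>+\<omega>. ennreal (max_dist (X k \<omega>) (Y \<omega>) powr p) \<partial>\<Omega>)"
      using nn_integral_distr[OF pair integrand] by simp
    also have "\<dots> = ennreal (D k)"
      unfolding D_def
    proof (rule nn_integral_eq_integral)
      show "integrable \<Omega> (\<lambda>\<omega>. max_dist (X k \<omega>) (Y \<omega>) powr p)"
        by (rule integrable_const_bound[of _ "b powr p"], rule AE_I2)
          (simp only: real_norm_def abs_of_nonneg[OF powr_ge_zero] b_powr, measurable)
    qed (rule AE_I2, rule powr_ge_zero)
    finally show "(\<integral>\<^sup>+z. ennreal (max_dist (fst z) (snd z) powr p) \<partial>?\<gamma>) = ennreal (D k)" .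
  qed
  show ?thesis
  proof (rule tendsto_sandwich)
    show "(\<lambda>_. 0) \<longlonglongrightarrow> (0 :: ennreal)"
      by (rule tendsto_const)
    show "\<forall>\<^sub>F k in sequentially. 0 \<le> wasserstein max_dist p (distr \<Omega> borel (X k)) (distr \<Omega> borel Y)"
      by simp
    show "\<forall>\<^sub>F k in sequentially. wasserstein max_dist p (distr \<Omega> borel (X k)) (distr \<Omega> borel Y) \<le> ennreal (D k powr (1 / p))"
      by (intro always_eventually allI bound)
  qed (rule upper)
qed

section \<open>Limits of approximating sequences\<close>

text \<open>Meant for costs that depend on one coordinate only: these give all transport plans the
  same cost, fixed by a marginal. The plans obtained by spreading vary with \<open>k\<close>, but
  their cost is always \<open>v\<close>, and the discrete costs differ from it by at most the
  modulus.\<close>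

lemma transport_cost_const_tendsto:
  fixes \<mu> :: "'a::polish_space measure" and \<nu> :: "'b::polish_space measure"
  assumes f: "compact_OT_problem \<mu> \<nu> f" and v: "\<And>\<pi>. \<pi> \<in> transport_plans \<mu> \<nu> \<Longrightarrow> transport_cost f \<pi> = v"
    and w: "\<And>k. h_plan \<mu> \<nu> (h k) (S k) (T k) (w k)" and h: "\<And>k. 0 \<le> h k" "h \<longlonglongrightarrow> 0"
  shows "(\<lambda>k. transport_cost f (plan_measure (S k) (T k) (w k))) \<longlonglongrightarrow> v"
proof -
  have \<mu>: "\<mu> \<in> space (prob_algebra borel)" and \<nu>: "\<nu> \<in> space (prob_algebra borel)"
    using f by (auto simp: compact_OT_problem_def OT_problem_def)
  have "\<bar>transport_cost f (plan_measure (S k) (T k) (w k)) - v\<bar> \<le> cost_modulus f (h k)" for k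
  proof -
    have S: "h_partition (h k) (S k)" and T: "h_partition (h k) (T k)"
      using w[of k] by (auto simp: h_plan_def)
    show ?thesis
    proof (rule h_plan_spread[OF \<mu> \<nu> w[of k]])
      fix \<pi> assume \<pi>: "\<pi> \<in> transport_plans \<mu> \<nu>"
        and eq: "\<And>i j. i \<in> index (S k) \<Longrightarrow> j \<in> index (T k) \<Longrightarrow> measure \<pi> (cell (S k) i \<times> cell (T k) j) = w k i j"
      show ?thesis
        using transport_cost_discretization[OF f \<pi> S T h(1) eq] v[OF \<pi>] by simp
    qed
  qed
  then have "(\<lambda>k. transport_cost f (plan_measure (S k) (T k) (w k)) - v) \<longlonglongrightarrow> 0"
    by (intro Lim_null_comparison[OF always_eventually cost_modulus_tendsto_0[OF f h]]) simp
  then show ?thesis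
    by (simp add: LIM_zero_iff)
qed

lemma approximating_sequence_cost_tendsto:
  fixes \<mu> :: "'a::polish_space measure" and \<nu> :: "'b::polish_space measure"
  assumes c: "compact_OT_problem \<mu> \<nu> c" and "approximating_sequence \<mu> \<nu> c S T w"
  shows "(\<lambda>k. transport_cost c (plan_measure (S k) (T k) (w k))) \<longlonglongrightarrow> Kantorovich_value \<mu> \<nu> c"
proof -
  obtain \<epsilon> h where lim: "\<epsilon> \<longlonglongrightarrow> 0" "h \<longlonglongrightarrow> 0"
    and opt: "\<And>k. eps_optimal_h_plan \<mu> \<nu> c (\<epsilon> k) (h k) (S k) (T k) (w k)"
    using assms(2) unfolding approximating_sequence_def by blast
  have h: "0 \<le> h k" for k
    using opt[of k] by (simp add: eps_optimal_h_plan_def)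
  have "(\<lambda>k. cost_modulus c (h k) + \<epsilon> k) \<longlonglongrightarrow> 0"
    using tendsto_add[OF cost_modulus_tendsto_0[OF c h lim(2)] lim(1)] by simp
  then have "(\<lambda>k. transport_cost c (plan_measure (S k) (T k) (w k)) - Kantorovich_value \<mu> \<nu> c) \<longlonglongrightarrow> 0"
    by (rule Lim_null_comparison[rotated]) (simp add: h_plan_cost_bound[OF c opt])
  then show ?thesis
    by (simp add: LIM_zero_iff)
qed

lemma approximating_sequence_subseq:
  assumes "approximating_sequence \<mu> \<nu> c S T w" "strict_mono r"
  shows "approximating_sequence \<mu> \<nu> c (S \<circ> r) (T \<circ> r) (w \<circ> r)"
proof -
  obtain \<epsilon> h where lim: "\<epsilon> \<longlonglongrightarrow> 0" "h \<longlonglongrightarrow> 0"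
    and opt: "\<And>k. eps_optimal_h_plan \<mu> \<nu> c (\<epsilon> k) (h k) (S k) (T k) (w k)"
    using assms(1) unfolding approximating_sequence_def by blast
  show ?thesis
    unfolding approximating_sequence_def
  proof (intro exI conjI allI)
    show "(\<epsilon> \<circ> r) \<longlonglongrightarrow> 0" "(h \<circ> r) \<longlonglongrightarrow> 0"
      using lim by (auto intro: LIMSEQ_subseq_LIMSEQ[OF _ assms(2)])
    show "eps_optimal_h_plan \<mu> \<nu> c ((\<epsilon> \<circ> r) k) ((h \<circ> r) k) ((S \<circ> r) k) ((T \<circ> r) k) ((w \<circ> r) k)" for k
      using opt by simp
  qed
qed

text \<open>The subsequence and the limit are chosen before \<open>p\<close>, since one almost
  surely convergent family of random variables handles all exponents at once.\<close>

lemma approximating_sequence_limit_plan: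
  fixes \<mu> :: "'a::polish_space measure" and \<nu> :: "'b::polish_space measure"
  assumes c: "compact_OT_problem \<mu> \<nu> c" and w: "approximating_sequence \<mu> \<nu> c S T w"
  obtains r \<pi> where "strict_mono (r :: nat \<Rightarrow> nat)" "\<pi> \<in> optimal_plans \<mu> \<nu> c"
    "\<forall>p\<ge>1. (\<lambda>k. wasserstein max_dist p (plan_measure (S (r k)) (T (r k)) (w (r k))) \<pi>) \<longlonglongrightarrow> 0"
proof -
  obtain \<epsilon> h where "\<epsilon> \<longlonglongrightarrow> 0" and h_lim: "h \<longlonglongrightarrow> 0"
    and opt: "\<And>k. eps_optimal_h_plan \<mu> \<nu> c (\<epsilon> k) (h k) (S k) (T k) (w k)"
    using w unfolding approximating_sequence_def by blast
  have h: "0 \<le> h k" and plan: "h_plan \<mu> \<nu> (h k) (S k) (T k) (w k)" for k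
    using opt[of k] by (auto simp: eps_optimal_h_plan_def)
  have \<mu>: "\<mu> \<in> space (prob_algebra borel)" and \<nu>: "\<nu> \<in> space (prob_algebra borel)"
    and cpt: "compact (UNIV :: 'a set)" "compact (UNIV :: 'b set)" and cont: "continuous_on UNIV c"
    using c by (auto simp: compact_OT_problem_def OT_problem_def)
  have cpt2: "compact (UNIV :: ('a \<times> 'b) set)"
    by (rule compact_UNIV_prod[OF cpt])
  define P where "P k = plan_measure (S k) (T k) (w k)" for k
  have P: "P k \<in> space (prob_algebra borel)" for k
    unfolding P_def using \<mu> plan by (rule plan_measure_prob)
  obtain r :: "nat \<Rightarrow> nat" and \<Omega> :: "real measure" and X Y where r: "strict_mono r"
    and \<Omega>: "prob_space \<Omega>" and X: "\<And>k. X k \<in> borel_measurable \<Omega>" and Y: "Y \<in> borel_measurable \<Omega>"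
    and distr_X: "\<And>k. distr \<Omega> borel (X k) = P (r k)" and lim: "AE \<omega> in \<Omega>. (\<lambda>k. X k \<omega>) \<longlonglongrightarrow> Y \<omega>"
    by (rule compact_skorohod_subsequence[OF cpt2 P]) (rule that)
  define Q where "Q = distr \<Omega> borel Y"
  have Q: "Q \<in> space (prob_algebra borel)"
    unfolding Q_def using prob_space.prob_space_distr[OF \<Omega> Y] by (simp add: space_prob_algebra)
  have weak: "(\<lambda>k. transport_cost f (P (r k))) \<longlonglongrightarrow> transport_cost f Q" if "continuous_on UNIV f" for f
    unfolding transport_cost_def Q_def distr_X[symmetric]
    by (rule integral_distr_tendsto[OF cpt2 that \<Omega> X Y lim])
  have fst_borel[measurable]: "fst \<in> borel_measurable (borel :: ('a \<times> 'b) measure)"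
    and snd_borel[measurable]: "snd \<in> borel_measurable (borel :: ('a \<times> 'b) measure)"
    by (auto intro!: borel_measurable_continuous_onI continuous_intros)
  note meas = measurable_prob_algebra_borel
  \<comment> \<open>Weak convergence along \<open>r\<close> and convergence of the whole sequence to
    \<open>v\<close> must agree. With \<open>f\<close> composed with \<open>fst\<close> or
    \<open>snd\<close> this identifies the marginals of \<open>Q\<close>.\<close>
  have limit_eq: "transport_cost f Q = v"
    if f: "continuous_on UNIV f" and v: "\<And>\<pi>. \<pi> \<in> transport_plans \<mu> \<nu> \<Longrightarrow> transport_cost f \<pi> = v" for f v
  proof -
    have "compact_OT_problem \<mu> \<nu> f"
      using \<mu> \<nu> cpt f by (simp add: compact_OT_problem_def OT_problem_def borel_measurable_continuous_onI)
    then have "(\<lambda>k. transport_cost f (P k)) \<longlonglongrightarrow> v"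
      unfolding P_def using v plan h h_lim by (rule transport_cost_const_tendsto)
    from LIMSEQ_subseq_LIMSEQ[OF this r] show ?thesis
      using LIMSEQ_unique[OF weak[OF f]] by (simp add: comp_def)
  qed
  have "distr Q borel fst = \<mu>"
  proof (rule prob_measure_eqI_continuous[OF _ \<mu>])
    show "distr Q borel fst \<in> space (prob_algebra borel)"
      using Q prob_space.prob_space_distr[OF _ meas[OF Q fst_borel]] by (simp add: space_prob_algebra)
    fix f :: "'a \<Rightarrow> real" assume f: "continuous_on UNIV f"
    have f_meas: "f \<in> borel_measurable borel"
      using f by (rule borel_measurable_continuous_onI)
    have "transport_cost (\<lambda>z. f (fst z)) \<pi> = (\<integral>x. f x \<partial>\<mu>)" if "\<pi> \<in> transport_plans \<mu> \<nu>" for \<pi>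
      using that integral_distr[OF meas[OF _ fst_borel] f_meas, of \<pi>]
      by (auto simp: transport_plans_def transport_cost_def)
    then have "transport_cost (\<lambda>z. f (fst z)) Q = (\<integral>x. f x \<partial>\<mu>)"
      by (intro limit_eq continuous_on_compose2[OF f] continuous_intros) auto
    then show "(\<integral>x. f x \<partial>distr Q borel fst) = (\<integral>x. f x \<partial>\<mu>)"
      using integral_distr[OF meas[OF Q fst_borel] f_meas] by (simp add: transport_cost_def)
  qed
  moreover have "distr Q borel snd = \<nu>"
  proof (rule prob_measure_eqI_continuous[OF _ \<nu>])
    show "distr Q borel snd \<in> space (prob_algebra borel)"
      using Q prob_space.prob_space_distr[OF _ meas[OF Q snd_borel]] by (simp add: space_prob_algebra)
    fix f :: "'b \<Rightarrow> real" assume f: "continuous_on UNIV f"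
    have f_meas: "f \<in> borel_measurable borel"
      using f by (rule borel_measurable_continuous_onI)
    have "transport_cost (\<lambda>z. f (snd z)) \<pi> = (\<integral>x. f x \<partial>\<nu>)" if "\<pi> \<in> transport_plans \<mu> \<nu>" for \<pi>
      using that integral_distr[OF meas[OF _ snd_borel] f_meas, of \<pi>]
      by (auto simp: transport_plans_def transport_cost_def)
    then have "transport_cost (\<lambda>z. f (snd z)) Q = (\<integral>x. f x \<partial>\<nu>)"
      by (intro limit_eq continuous_on_compose2[OF f] continuous_intros) auto
    then show "(\<integral>x. f x \<partial>distr Q borel snd) = (\<integral>x. f x \<partial>\<nu>)"
      using integral_distr[OF meas[OF Q snd_borel] f_meas] by (simp add: transport_cost_def)
  qed
  \<comment> \<open>The costs along \<open>r\<close> tend to the integral against \<open>Q\<close>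
    and also to the Kantorovich value.\<close>
  moreover have "transport_cost c Q = Kantorovich_value \<mu> \<nu> c"
    using LIMSEQ_unique[OF weak[OF cont]]
      LIMSEQ_subseq_LIMSEQ[OF approximating_sequence_cost_tendsto[OF c w] r]
    by (simp add: comp_def P_def)
  ultimately have "Q \<in> optimal_plans \<mu> \<nu> c"
    using Q by (simp add: optimal_plans_def transport_plans_def)
  moreover have "(\<lambda>k. wasserstein max_dist p (P (r k)) Q) \<longlonglongrightarrow> 0" if "1 \<le> p" for p
    unfolding Q_def distr_X[symmetric] by (rule wasserstein_tendsto_0[OF cpt \<Omega> X Y lim that])
  ultimately show thesis
    using r by (intro that[of r Q]) (auto simp: P_def)
qed

text \<open>If the distances stayed at or above some \<open>u > 0\<close> along a subsequence, that
  subsequence would again be approximating, and a further one would converge to an optimal plan.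
  Which plan this is does not matter, since only the distance to the whole set is measured.\<close>

lemma approximating_sequence_wasserstein_tendsto:
  fixes \<mu> :: "'a::polish_space measure" and \<nu> :: "'b::polish_space measure"
  assumes c: "compact_OT_problem \<mu> \<nu> c" and w: "approximating_sequence \<mu> \<nu> c S T w" and "1 \<le> p"
  shows "(\<lambda>k. wasserstein_set max_dist p (plan_measure (S k) (T k) (w k)) (optimal_plans \<mu> \<nu> c)) \<longlonglongrightarrow> 0"
    (is "?W \<longlonglongrightarrow> 0")
proof (rule order_tendstoI)
  \<comment> \<open>Only upper bounds need an argument: no extended nonnegative real lies below
    0.\<close>
  fix u :: ennreal assume "0 < u"
  show "\<forall>\<^sub>F k in sequentially. ?W k < u"
  proof (rule ccontr)
    assume "\<not> (\<forall>\<^sub>F k in sequentially. ?W k < u)"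
    from not_eventually_sequentiallyD[OF this]
    obtain r :: "nat \<Rightarrow> nat" where r: "strict_mono r" "\<forall>k. \<not> ?W (r k) < u"
      by (elim exE conjE)
    obtain s \<pi> where \<pi>: "\<pi> \<in> optimal_plans \<mu> \<nu> c"
      and lim: "\<forall>p\<ge>1. (\<lambda>k. wasserstein max_dist p (plan_measure ((S \<circ> r) (s k)) ((T \<circ> r) (s k)) ((w \<circ> r) (s k))) \<pi>) \<longlonglongrightarrow> 0"
      by (rule approximating_sequence_limit_plan[OF c approximating_sequence_subseq[OF w r(1)]]) (rule that)
    have "(\<lambda>k. wasserstein max_dist p (plan_measure ((S \<circ> r) (s k)) ((T \<circ> r) (s k)) ((w \<circ> r) (s k))) \<pi>) \<longlonglongrightarrow> 0"
      using lim \<open>1 \<le> p\<close> by blast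
    from eventually_happens'[OF sequentially_bot order_tendstoD(2)[OF this \<open>0 < u\<close>]]
    obtain k where "wasserstein max_dist p (plan_measure (S (r (s k))) (T (r (s k))) (w (r (s k)))) \<pi> < u"
      unfolding comp_def by (elim exE)
    moreover have "?W (r (s k)) \<le> wasserstein max_dist p (plan_measure (S (r (s k))) (T (r (s k))) (w (r (s k)))) \<pi>"
      unfolding wasserstein_set_def using \<pi> by (rule INF_lower)
    ultimately have "?W (r (s k)) < u"
      by (rule le_less_trans[rotated])
    then show False
      using r(2) by blast
  qed
qed simp

theorem theoremA:
  fixes \<mu> :: "'a::polish_space measure" and \<nu> :: "'b::polish_space measure"
    and c :: "'a \<times> 'b \<Rightarrow> real"
  assumes "compact_OT_problem \<mu> \<nu> c"
  shows
    "(\<forall>h \<epsilon> (S :: ('i, 'a) tagged_family) (T :: ('j, 'b) tagged_family) w.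
        0 \<le> h \<longrightarrow> 0 \<le> \<epsilon> \<longrightarrow> eps_optimal_h_plan \<mu> \<nu> c \<epsilon> h S T w \<longrightarrow>
          \<bar>transport_cost c (plan_measure S T w) - Kantorovich_value \<mu> \<nu> c\<bar> \<le> cost_modulus c h + \<epsilon>) \<and>
     (\<forall>(S :: nat \<Rightarrow> ('i, 'a) tagged_family) (T :: nat \<Rightarrow> ('j, 'b) tagged_family) w.
        approximating_sequence \<mu> \<nu> c S T w \<longrightarrow>
          (\<lambda>k. transport_cost c (plan_measure (S k) (T k) (w k))) \<longlonglongrightarrow> Kantorovich_value \<mu> \<nu> c \<and>
          (\<forall>p\<ge>1. (\<lambda>k. wasserstein_set max_dist p (plan_measure (S k) (T k) (w k))
                        (optimal_plans \<mu> \<nu> c)) \<longlonglongrightarrow> 0) \<and>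
          (\<forall>\<pi>. optimal_plans \<mu> \<nu> c = {\<pi>} \<longrightarrow>
             (\<forall>p\<ge>1. (\<lambda>k. wasserstein max_dist p (plan_measure (S k) (T k) (w k)) \<pi>) \<longlonglongrightarrow> 0)))"
proof (intro conjI allI impI)
  fix h \<epsilon> w and S :: "('i, 'a) tagged_family" and T :: "('j, 'b) tagged_family"
  assume "eps_optimal_h_plan \<mu> \<nu> c \<epsilon> h S T w"
  then show "\<bar>transport_cost c (plan_measure S T w) - Kantorovich_value \<mu> \<nu> c\<bar> \<le> cost_modulus c h + \<epsilon>"
    by (rule h_plan_cost_bound[OF assms])
next
  fix w and S :: "nat \<Rightarrow> ('i, 'a) tagged_family" and T :: "nat \<Rightarrow> ('j, 'b) tagged_family"
  assume w: "approximating_sequence \<mu> \<nu> c S T w"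
  show "(\<lambda>k. transport_cost c (plan_measure (S k) (T k) (w k))) \<longlonglongrightarrow> Kantorovich_value \<mu> \<nu> c"
    by (rule approximating_sequence_cost_tendsto[OF assms w])
  fix p :: real assume p: "1 \<le> p"
  note lim = approximating_sequence_wasserstein_tendsto[OF assms w p]
  show "(\<lambda>k. wasserstein_set max_dist p (plan_measure (S k) (T k) (w k)) (optimal_plans \<mu> \<nu> c)) \<longlonglongrightarrow> 0"
    by (rule lim)
  \<comment> \<open>Over a singleton the infimum defining \<open>wasserstein_set\<close> is the
    distance to its element.\<close>
  fix \<pi> assume "optimal_plans \<mu> \<nu> c = {\<pi>}"
  then show "(\<lambda>k. wasserstein max_dist p (plan_measure (S k) (T k) (w k)) \<pi>) \<longlonglongrightarrow> 0"
    using lim by (simp add: wasserstein_set_def)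
qed

end
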